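(* Let $(K,v_0)$ be a valued field and let $K(x)$ be the rational function field in one variable over $K$. Assume that $K$ is algebraically closed or that $(K,v_0)$ lies dense in its algebraic closure. Then the extensions $v$ of $v_0$ to $K(x)$ are fully characterized by the approximation types $\mathrm{appr}_v(x,K)$: if $\mathcal V$ denotes the set of all extensions of $v_0$ to $K(x)$ and $\mathcal A$ the set of all non-trivial approximation types over $(K,v_0)$, then the function $\mathcal V\to\mathcal A$, $v\mapsto \mathrm{appr}_v(x,K)$, is a bijection.
   Context: Valuations are Krull valuations written additively; $vK$ is the value group and $\infty$ is larger than all values. Extensions of $v_0$ are identified when they are equivalent over $v_0$ (differ by an order preserving isomorphism of value groups that is the identity on $v_0K$). $(K,v_0)$ lies dense in its algebraic closure $\tilde K$ if for some (equivalently, every) extension $v$ of $v_0$ to $\tilde K$, for all $a\in\tilde K$ and $\alpha\in v\tilde K$ there is $c\in K$ with $v(a-c)>\alpha$. Balls: for $c\in K$, the closed ball of radius $\gamma\in vK\cup\{\infty\}$ is $B_\gamma(c,K)=\{a\in K\mid v(a-c)\ge\gamma\}$, and the open ball of radius $\gamma\in vK$ is $B^\circ_\gamma(c,K)=\{a\in K\mid v(a-c)>\gamma\}$. Balls are recorded together with their radius and their kind (open/closed). An approximation type $\mathbf A$ over $(K,v)$ is a (possibly empty) collection of closed and open balls in $(K,v)$, any two of which are comparable by inclusion, such that whenever $\mathbf A$ contains a (closed or open) ball with center $c$ and radius $\gamma$, it contains $B_\beta(c,K)$ and $B_\beta^\circ(c,K)$ for all $\beta\in vK$ with $\beta<\gamma$,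 and whenever it contains $B^\circ_\gamma(c,K)$ it contains $B_\gamma(c,K)$. Its support $\mathrm{supp}\,\mathbf A$ is the set of all $\gamma\in vK\cup\{\infty\}$ such that $\mathbf A$ contains a closed ball of radius $\gamma$. $\mathbf A$ is trivial if $\infty\in\mathrm{supp}\,\mathbf A$ (equivalently, $\mathbf A=\mathrm{appr}_v(c,K)$ for some $c\in K$). For an extension $(L|K,v)$ of valued fields and $x\in L$, $\mathrm{appr}_v(x,K)$ is the approximation type over $(K,v)$ consisting of all nonempty sets $\{c\in K\mid v(x-c)\ge\gamma\}$, $\gamma\in vK\cup\{\infty\}$ (as closed balls of radius $\gamma$), and all nonempty sets $\{c\in K\mid v(x-c)>\gamma\}$, $\gamma\in vK$ (as open balls of radius $\gamma$). *)

theory Defs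
  imports "HOL-Algebra.Algebraic_Closure_Type"
begin

section \<open>Ordered abelian groups and Krull valuations\<close>

text \<open>
  Value groups are groups on a carrier set, since the value group of an extension cannot be fixed
  in advance as a type. Valuations are additive in the mathematical sources; here the addition of
  values is the operation of a commutative group in the sense of HOL-Algebra.
\<close>

record 'g ogroup = "'g monoid" +
  ole :: "'g rel"

locale ordered_ab_group = comm_group G for G :: "'g ogroup" (structure) +
  assumes linear: "linear_order_on (carrier G) (ole G)"
    and translate: "\<lbrakk>(a, b) \<in> ole G; c \<in> carrier G\<rbrakk> \<Longrightarrow> (c \<otimes> a, c \<otimes> b) \<in> ole G"

definition order_embedding :: "'g ogroup \<Rightarrow> 'h ogroup \<Rightarrow> ('g \<Rightarrow> 'h) \<Rightarrow> bool" where
  "order_embedding G H \<iota> \<longleftrightarrow> \<iota> \<in> hom G H \<and>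
     (\<forall>a\<in>carrier G. \<forall>b\<in>carrier G. (a, b) \<in> ole G \<longleftrightarrow> (\<iota> a, \<iota> b) \<in> ole H)"

datatype 'g ext = Fin 'g | Infty

definition ext_carrier :: "'g ogroup \<Rightarrow> 'g ext set" where
  "ext_carrier G = insert Infty (Fin ` carrier G)"

fun ext_le :: "'g ogroup \<Rightarrow> 'g ext \<Rightarrow> 'g ext \<Rightarrow> bool" where
  "ext_le G x Infty = True"
| "ext_le G Infty (Fin b) = False"
| "ext_le G (Fin a) (Fin b) = ((a, b) \<in> ole G)"

definition ext_less :: "'g ogroup \<Rightarrow> 'g ext \<Rightarrow> 'g ext \<Rightarrow> bool" where
  "ext_less G x y \<longleftrightarrow> ext_le G x y \<and> x \<noteq> y"

definition ext_min :: "'g ogroup \<Rightarrow> 'g ext \<Rightarrow> 'g ext \<Rightarrow> 'g ext" where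
  "ext_min G x y = (if ext_le G x y then x else y)"

fun ext_add :: "'g ogroup \<Rightarrow> 'g ext \<Rightarrow> 'g ext \<Rightarrow> 'g ext" where
  "ext_add G (Fin a) (Fin b) = Fin (a \<otimes>\<^bsub>G\<^esub> b)"
| "ext_add G _ _ = Infty"

text \<open>
  \<open>G\<close> is the value group itself, not merely a group containing it. Trivial valuations are allowed.
\<close>

definition valuation :: "'g ogroup \<Rightarrow> ('k::field \<Rightarrow> 'g ext) \<Rightarrow> bool" where
  "valuation G v \<longleftrightarrow> ordered_ab_group G \<and>
     v 0 = Infty \<and> v ` (UNIV - {0}) = Fin ` carrier G \<and>
     (\<forall>a b. v (a * b) = ext_add G (v a) (v b)) \<and>
     (\<forall>a b. ext_le G (ext_min G (v a) (v b)) (v (a + b)))"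


section \<open>Extensions of a valuation, up to equivalence\<close>

text \<open>
  An extension of \<open>(K, v\<^sub>0)\<close>, with value group \<open>G\<close>, along a field embedding \<open>i\<close> of \<open>K\<close> in \<open>L\<close> is a
  triple \<open>(H, \<iota>, v)\<close>: a valuation \<open>v\<close> of \<open>L\<close> with value group \<open>H\<close>, together with the inclusion \<open>\<iota>\<close> of
  the value group of \<open>v\<^sub>0\<close> in \<open>H\<close>, through which the restriction of \<open>v\<close> to \<open>K\<close> is \<open>v\<^sub>0\<close>.
\<close>

type_synonym ('g, 'u, 'l) extension = "'u ogroup \<times> ('g \<Rightarrow> 'u) \<times> ('l \<Rightarrow> 'u ext)"

definition extensions ::
    "('k::field \<Rightarrow> 'l::field) \<Rightarrow> 'g ogroup \<Rightarrow> ('k \<Rightarrow> 'g ext) \<Rightarrow> ('g, 'u, 'l) extension set" where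
  "extensions i G v0 = {(H, \<iota>, v). valuation H v \<and> order_embedding G H \<iota> \<and>
                                   (\<forall>a. v (i a) = map_ext \<iota> (v0 a))}"

text \<open>
  Equivalence over \<open>v\<^sub>0\<close>: an order preserving isomorphism of the value groups which is the identity
  on the value group of \<open>v\<^sub>0\<close> carries one valuation to the other.
\<close>

fun equivalent_over ::
    "'g ogroup \<Rightarrow> ('g, 'u, 'l) extension \<Rightarrow> ('g, 'w, 'l) extension \<Rightarrow> bool" where
  "equivalent_over G (H, \<iota>, v) (H', \<iota>', v') \<longleftrightarrow>
     (\<exists>\<sigma>. \<sigma> \<in> iso H H' \<and> order_embedding H H' \<sigma> \<and>
          (\<forall>\<gamma>\<in>carrier G. \<sigma> (\<iota> \<gamma>) = \<iota>' \<gamma>) \<and> (\<forall>f. v' f = map_ext \<sigma> (v f)))"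

definition extension_equiv ::
    "('k::field \<Rightarrow> 'l::field) \<Rightarrow> 'g ogroup \<Rightarrow> ('k \<Rightarrow> 'g ext) \<Rightarrow> ('g, 'u, 'l) extension rel" where
  "extension_equiv i G v0 =
     {(E, E'). E \<in> extensions i G v0 \<and> E' \<in> extensions i G v0 \<and> equivalent_over G E E'}"

definition extension_classes ::
    "('k::field \<Rightarrow> 'l::field) \<Rightarrow> 'g ogroup \<Rightarrow> ('k \<Rightarrow> 'g ext) \<Rightarrow> ('g, 'u, 'l) extension set set" where
  "extension_classes i G v0 = extensions i G v0 // extension_equiv i G v0"

lemma equivalent_over_refl: "equivalent_over G E E"
proof -
  obtain H \<iota> v where E: "E = (H, \<iota>, v)" by (cases E) auto
  have "id \<in> iso H H" by (auto simp: iso_def hom_def)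
  moreover have "order_embedding H H id" by (auto simp: order_embedding_def hom_def)
  moreover have "\<forall>f. v f = map_ext id (v f)" by (simp add: ext.map_id)
  ultimately show ?thesis unfolding E by (simp only: equivalent_over.simps) (metis id_apply)
qed

lemma equivalent_over_trans:
  assumes "equivalent_over G E1 E2" "equivalent_over G E2 E3"
  shows "equivalent_over G E1 E3"
proof -
  obtain H1 i1 v1 H2 i2 v2 H3 i3 v3
    where E: "E1 = (H1, i1, v1)" "E2 = (H2, i2, v2)" "E3 = (H3, i3, v3)"
    by (cases E1, cases E2, cases E3) auto
  obtain s where s: "s \<in> iso H1 H2" "order_embedding H1 H2 s"
      "\<forall>\<gamma>\<in>carrier G. s (i1 \<gamma>) = i2 \<gamma>" "\<forall>f. v2 f = map_ext s (v1 f)"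
    using assms(1) unfolding E by auto
  obtain t where t: "t \<in> iso H2 H3" "order_embedding H2 H3 t"
      "\<forall>\<gamma>\<in>carrier G. t (i2 \<gamma>) = i3 \<gamma>" "\<forall>f. v3 f = map_ext t (v2 f)"
    using assms(2) unfolding E by auto
  have sc: "s a \<in> carrier H2" if "a \<in> carrier H1" for a
    using s(1) that by (auto simp: iso_def hom_def)
  have "t \<circ> s \<in> iso H1 H3" using s(1) t(1) by (rule iso_set_trans)
  moreover have "order_embedding H1 H3 (t \<circ> s)"
    using s(2) t(2) sc by (auto simp: order_embedding_def hom_def)
  moreover have "\<forall>\<gamma>\<in>carrier G. (t \<circ> s) (i1 \<gamma>) = i3 \<gamma>" using s(3) t(3) by simp
  moreover have "\<forall>f. v3 f = map_ext (t \<circ> s) (v1 f)"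
    using s(4) t(4) by (simp add: ext.map_comp)
  ultimately show ?thesis unfolding E by auto
qed

lemma equivalent_over_sym:
  assumes E1: "E1 \<in> extensions i G v0" and eq: "equivalent_over G E1 E2"
  shows "equivalent_over G E2 E1"
proof -
  obtain H1 i1 v1 H2 i2 v2 where E: "E1 = (H1, i1, v1)" "E2 = (H2, i2, v2)"
    by (cases E1, cases E2) auto
  obtain s where s: "s \<in> iso H1 H2" "order_embedding H1 H2 s"
      "\<forall>\<gamma>\<in>carrier G. s (i1 \<gamma>) = i2 \<gamma>" "\<forall>f. v2 f = map_ext s (v1 f)"
    using eq unfolding E by auto
  have val: "valuation H1 v1" and emb: "order_embedding G H1 i1"
    using E1 unfolding E extensions_def by auto
  have grp: "group H1"
    using val by (simp add: valuation_def ordered_ab_group_def comm_group_def)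
  define t where "t = inv_into (carrier H1) s"
  have bij: "bij_betw s (carrier H1) (carrier H2)" using s(1) by (simp add: iso_def)
  have ts: "t (s a) = a" if "a \<in> carrier H1" for a
    using bij that by (simp add: t_def bij_betw_def)
  have st: "s (t b) = b" "t b \<in> carrier H1" if "b \<in> carrier H2" for b
    using bij that by (auto simp: t_def bij_betw_def f_inv_into_f inv_into_into)
  have t_iso: "t \<in> iso H2 H1" unfolding t_def by (rule group.iso_set_sym[OF grp s(1)])
  moreover have "order_embedding H2 H1 t"
    using s(2) st t_iso by (auto simp: order_embedding_def iso_def)
  moreover have "\<forall>\<gamma>\<in>carrier G. t (i2 \<gamma>) = i1 \<gamma>"
  proof
    fix \<gamma> assume "\<gamma> \<in> carrier G"
    moreover from this have "i1 \<gamma> \<in> carrier H1" using emb by (auto simp: order_embedding_def hom_def)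
    ultimately show "t (i2 \<gamma>) = i1 \<gamma>" using s(3) ts by metis
  qed
  moreover have "v1 f = map_ext t (v2 f)" for f
  proof (cases "v1 f")
    case (Fin a)
    then have "f \<noteq> 0" using val by (auto simp: valuation_def)
    then have "v1 f \<in> Fin ` carrier H1" using val unfolding valuation_def by blast
    then show ?thesis using Fin s(4) ts by auto
  next
    case Infty
    then show ?thesis using s(4) by simp
  qed
  ultimately show ?thesis unfolding E by auto
qed

lemma equiv_extension_equiv: "equiv (extensions i G v0) (extension_equiv i G v0)"
proof (rule equivI)
  show "refl_on (extensions i G v0) (extension_equiv i G v0)"
    by (auto simp: refl_on_def extension_equiv_def equivalent_over_refl)
  show "sym (extension_equiv i G v0)"
    by (auto simp: sym_def extension_equiv_def intro: equivalent_over_sym simp del: equivalent_over.simps)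
  show "trans (extension_equiv i G v0)"
    unfolding trans_def extension_equiv_def using equivalent_over_trans by blast
qed (auto simp: extension_equiv_def)

text \<open>
  The values of the extensions in a set must be taken from one type. This is no restriction as
  soon as that type is as large as the field: every extension, with values in an arbitrary type,
  is equivalent to one with values in such a type.
\<close>

definition transport :: "('w \<Rightarrow> 'u) \<Rightarrow> 'w ogroup \<Rightarrow> 'u ogroup" where
  "transport h H = \<lparr>carrier = h ` carrier H,
     monoid.mult = (\<lambda>x y. h (inv_into (carrier H) h x \<otimes>\<^bsub>H\<^esub> inv_into (carrier H) h y)),
     monoid.one = h \<one>\<^bsub>H\<^esub>, ole = (\<lambda>(a, b). (h a, h b)) ` ole H\<rparr>"

lemma transport:
  assumes H: "ordered_ab_group H" and inj: "inj_on h (carrier H)"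
  shows "h \<in> iso H (transport h H)" "order_embedding H (transport h H) h"
    "ordered_ab_group (transport h H)"
proof -
  interpret ordered_ab_group H by (rule H)
  have sub: "ole H \<subseteq> carrier H \<times> carrier H"
    using linear by (simp add: order_on_defs)
  have inv: "inv_into (carrier H) h (h a) = a" if "a \<in> carrier H" for a
    using inj that by simp
  have mem: "(h a, h b) \<in> ole (transport h H) \<longleftrightarrow> (a, b) \<in> ole H"
    if "a \<in> carrier H" "b \<in> carrier H" for a b
    using that sub inj by (auto simp: transport_def dest: inj_onD)
  have mlt: "h a \<otimes>\<^bsub>transport h H\<^esub> h b = h (a \<otimes>\<^bsub>H\<^esub> b)"
    if "a \<in> carrier H" "b \<in> carrier H" for a b
    using that inv by (simp add: transport_def)
  have car: "carrier (transport h H) = h ` carrier H" and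
       one: "\<one>\<^bsub>transport h H\<^esub> = h \<one>\<^bsub>H\<^esub>"
    by (auto simp: transport_def)
  show iso: "h \<in> iso H (transport h H)"
    using inj by (auto simp: iso_def hom_def car mlt bij_betw_def)
  then show "order_embedding H (transport h H) h"
    by (auto simp: order_embedding_def iso_def mem)
  have grp: "comm_group (transport h H)"
  proof (rule comm_groupI)
    fix x assume "x \<in> carrier (transport h H)"
    then obtain a where a: "a \<in> carrier H" "x = h a" by (auto simp: car)
    then have "h (inv\<^bsub>H\<^esub> a) \<in> carrier (transport h H)"
      "h (inv\<^bsub>H\<^esub> a) \<otimes>\<^bsub>transport h H\<^esub> x = \<one>\<^bsub>transport h H\<^esub>"
      by (auto simp: car mlt one)
    then show "\<exists>y\<in>carrier (transport h H). y \<otimes>\<^bsub>transport h H\<^esub> x = \<one>\<^bsub>transport h H\<^esub>"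
      by blast
  qed (auto simp: car one mlt m_ac)
  have lin: "linear_order_on (carrier (transport h H)) (ole (transport h H))"
    unfolding order_on_defs
  proof (intro conjI)
    show "ole (transport h H) \<subseteq> carrier (transport h H) \<times> carrier (transport h H)"
      using sub by (auto simp: transport_def)
    show "refl_on (carrier (transport h H)) (ole (transport h H))"
      using linear by (auto simp: refl_on_def car mem order_on_defs)
    have tr: "(a, c) \<in> ole H" if "(a, b) \<in> ole H" "(b, c) \<in> ole H" for a b c
      using linear that unfolding order_on_defs by (meson transD)
    show "trans (ole (transport h H))"
    proof (rule transI)
      fix x y z assume "(x, y) \<in> ole (transport h H)" "(y, z) \<in> ole (transport h H)"
      moreover from this obtain a b where "x = h a" "y = h b" "(a, b) \<in> ole H"
        by (auto simp: transport_def)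
      moreover from calculation obtain b' c where "y = h b'" "z = h c" "(b', c) \<in> ole H"
        by (auto simp: transport_def)
      ultimately have *: "x = h a" "y = h b" "y = h b'" "z = h c"
        "(a, b) \<in> ole H" "(b', c) \<in> ole H" by simp_all
      then have "b = b'" using sub inj by (auto dest: inj_onD)
      then have "(a, c) \<in> ole H" using * tr by blast
      then show "(x, z) \<in> ole (transport h H)" using * by (auto simp: transport_def)
    qed
    show "antisym (ole (transport h H))"
    proof (rule antisymI)
      fix x y assume xy: "(x, y) \<in> ole (transport h H)" "(y, x) \<in> ole (transport h H)"
      then obtain a b where ab: "x = h a" "y = h b" "(a, b) \<in> ole H"
        by (auto simp: transport_def)
      then have "(b, a) \<in> ole H" using xy sub mem by blast
      then show "x = y" using ab linear by (auto simp: order_on_defs dest: antisymD)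
    qed
    show "total_on (carrier (transport h H)) (ole (transport h H))"
      using linear by (auto simp: total_on_def car mem order_on_defs)
  qed
  show "ordered_ab_group (transport h H)"
  proof (intro ordered_ab_group.intro ordered_ab_group_axioms.intro grp lin)
    fix x y z assume xy: "(x, y) \<in> ole (transport h H)" and z: "z \<in> carrier (transport h H)"
    obtain a b where ab: "x = h a" "y = h b" "(a, b) \<in> ole H"
      using xy by (auto simp: transport_def)
    obtain c where c: "z = h c" "c \<in> carrier H" using z by (auto simp: car)
    have "a \<in> carrier H" "b \<in> carrier H" using ab(3) sub by auto
    then show "(z \<otimes>\<^bsub>transport h H\<^esub> x, z \<otimes>\<^bsub>transport h H\<^esub> y) \<in> ole (transport h H)"
      using ab c by (simp add: mlt mem translate)
  qed
qed

lemma valuation_in_ext_carrier: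
  assumes "valuation G v"
  shows "v a \<in> ext_carrier G"
proof (cases "a = 0")
  case True
  then show ?thesis using assms by (simp add: valuation_def ext_carrier_def)
next
  case False
  then have "v a \<in> v ` (UNIV - {0})" by blast
  then show ?thesis using assms by (simp add: valuation_def ext_carrier_def)
qed

lemma valuation_transport:
  assumes v: "valuation H v" and inj: "inj_on h (carrier H)"
  shows "valuation (transport h H) (\<lambda>a. map_ext h (v a))"
proof -
  have H: "ordered_ab_group H" using v by (simp add: valuation_def)
  note T = transport[OF H inj]
  have le: "ext_le (transport h H) (map_ext h x) (map_ext h y) \<longleftrightarrow> ext_le H x y"
    if "x \<in> ext_carrier H" "y \<in> ext_carrier H" for x y
    using that T(2) by (auto simp: ext_carrier_def order_embedding_def)
  have mn: "ext_min (transport h H) (map_ext h x) (map_ext h y) = map_ext h (ext_min H x y)"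
    if "x \<in> ext_carrier H" "y \<in> ext_carrier H" for x y
    using that le by (simp add: ext_min_def)
  have ad: "ext_add (transport h H) (map_ext h x) (map_ext h y) = map_ext h (ext_add H x y)"
    if "x \<in> ext_carrier H" "y \<in> ext_carrier H" for x y
    using that T(1) by (auto simp: ext_carrier_def iso_def hom_def)
  have mc: "ext_min H (v a) (v b) \<in> ext_carrier H" for a b
    using valuation_in_ext_carrier[OF v] by (simp add: ext_min_def)
  have im: "(\<lambda>a. map_ext h (v a)) ` (UNIV - {0}) = Fin ` carrier (transport h H)"
  proof -
    have "(\<lambda>a. map_ext h (v a)) ` (UNIV - {0}) = map_ext h ` v ` (UNIV - {0})"
      by (simp only: image_image)
    also have "\<dots> = map_ext h ` Fin ` carrier H" using v by (simp add: valuation_def)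
    finally show ?thesis by (simp add: image_image transport_def)
  qed
  show ?thesis
    using v T(3) im valuation_in_ext_carrier[OF v] mc
    by (simp add: valuation_def ad mn le)
qed

lemma extension_in_universe:
  fixes E :: "('g, 'w, 'l::field) extension" and e :: "'l \<Rightarrow> 'u"
  assumes E: "E \<in> extensions i G v0" and e: "inj e"
  obtains E' :: "('g, 'u, 'l) extension" where "E' \<in> extensions i G v0" "equivalent_over G E E'"
proof -
  obtain H \<iota> v where EE: "E = (H, \<iota>, v)" by (cases E) auto
  have v: "valuation H v" and emb: "order_embedding G H \<iota>"
    and ext: "\<And>a. v (i a) = map_ext \<iota> (v0 a)"
    using E unfolding EE extensions_def by auto
  have ex: "\<exists>f. v f = Fin \<gamma>" if "\<gamma> \<in> carrier H" for \<gamma>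
  proof -
    have "Fin \<gamma> \<in> v ` (UNIV - {0})" using v that by (simp add: valuation_def)
    then show ?thesis by force
  qed
  define r where "r \<gamma> = (SOME f. v f = Fin \<gamma>)" for \<gamma>
  have r: "v (r \<gamma>) = Fin \<gamma>" if "\<gamma> \<in> carrier H" for \<gamma>
    unfolding r_def using ex[OF that] by (rule someI_ex)
  define h where "h = e \<circ> r"
  have inj: "inj_on h (carrier H)"
  proof (rule inj_onI)
    fix a b assume "a \<in> carrier H" "b \<in> carrier H" "h a = h b"
    moreover from this have "r a = r b" using e by (simp add: h_def inj_eq)
    ultimately show "a = b" using r by (metis ext.inject)
  qed
  note T = transport[OF _ inj]
  have H: "ordered_ab_group H" using v by (simp add: valuation_def)
  let ?E' = "(transport h H, h \<circ> \<iota>, \<lambda>a. map_ext h (v a))"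
  have "order_embedding G (transport h H) (h \<circ> \<iota>)"
    using emb T(2)[OF H] by (auto simp: order_embedding_def hom_def Pi_iff)
  then have "?E' \<in> extensions i G v0"
    using valuation_transport[OF v inj] ext by (simp add: extensions_def ext.map_comp)
  moreover have "equivalent_over G E ?E'"
    unfolding EE using T(1,2)[OF H] by auto
  ultimately show ?thesis by (rule that)
qed


section \<open>Balls and approximation types\<close>

text \<open>
  A ball is recorded together with its kind and its radius.
\<close>

datatype ('k, 'g) ball = Closed "'g ext" (points: "'k set") | Open 'g (points: "'k set")

definition closed_ball :: "'g ogroup \<Rightarrow> ('k::field \<Rightarrow> 'g ext) \<Rightarrow> 'g ext \<Rightarrow> 'k \<Rightarrow> ('k, 'g) ball" where
  "closed_ball G v \<gamma> c = Closed \<gamma> {a. ext_le G \<gamma> (v (a - c))}"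

definition open_ball :: "'g ogroup \<Rightarrow> ('k::field \<Rightarrow> 'g ext) \<Rightarrow> 'g \<Rightarrow> 'k \<Rightarrow> ('k, 'g) ball" where
  "open_ball G v \<gamma> c = Open \<gamma> {a. ext_less G (Fin \<gamma>) (v (a - c))}"

definition balls :: "'g ogroup \<Rightarrow> ('k::field \<Rightarrow> 'g ext) \<Rightarrow> ('k, 'g) ball set" where
  "balls G v = {closed_ball G v \<gamma> c | \<gamma> c. \<gamma> \<in> ext_carrier G} \<union>
               {open_ball G v \<gamma> c | \<gamma> c. \<gamma> \<in> carrier G}"

definition approx_type :: "'g ogroup \<Rightarrow> ('k::field \<Rightarrow> 'g ext) \<Rightarrow> ('k, 'g) ball set \<Rightarrow> bool" where
  "approx_type G v A \<longleftrightarrow> A \<subseteq> balls G v \<and>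
     (\<forall>B\<in>A. \<forall>B'\<in>A. points B \<subseteq> points B' \<or> points B' \<subseteq> points B) \<and>
     (\<forall>c. \<forall>\<gamma>\<in>ext_carrier G. closed_ball G v \<gamma> c \<in> A \<longrightarrow>
        (\<forall>\<beta>\<in>carrier G. ext_less G (Fin \<beta>) \<gamma> \<longrightarrow>
           closed_ball G v (Fin \<beta>) c \<in> A \<and> open_ball G v \<beta> c \<in> A)) \<and>
     (\<forall>c. \<forall>\<gamma>\<in>carrier G. open_ball G v \<gamma> c \<in> A \<longrightarrow>
        closed_ball G v (Fin \<gamma>) c \<in> A \<and>
        (\<forall>\<beta>\<in>carrier G. ext_less G (Fin \<beta>) (Fin \<gamma>) \<longrightarrow>
           closed_ball G v (Fin \<beta>) c \<in> A \<and> open_ball G v \<beta> c \<in> A))"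

definition supp :: "'g ogroup \<Rightarrow> ('k, 'g) ball set \<Rightarrow> 'g ext set" where
  "supp G A = {\<gamma> \<in> ext_carrier G. \<exists>S. Closed \<gamma> S \<in> A}"

definition trivial_type :: "'g ogroup \<Rightarrow> ('k, 'g) ball set \<Rightarrow> bool" where
  "trivial_type G A \<longleftrightarrow> Infty \<in> supp G A"

fun appr :: "('k::field \<Rightarrow> 'l::field) \<Rightarrow> 'g ogroup \<Rightarrow> 'l \<Rightarrow> ('g, 'u, 'l) extension \<Rightarrow> ('k, 'g) ball set" where
  "appr i G x (H, \<iota>, v) =
     {Closed \<gamma> S | \<gamma> S. \<gamma> \<in> ext_carrier G \<and> S = {c. ext_le H (map_ext \<iota> \<gamma>) (v (x - i c))} \<and> S \<noteq> {}} \<union>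
     {Open \<gamma> S | \<gamma> S. \<gamma> \<in> carrier G \<and> S = {c. ext_less H (Fin (\<iota> \<gamma>)) (v (x - i c))} \<and> S \<noteq> {}}"


section \<open>Density in the algebraic closure\<close>

text \<open>
  The type argument is the type from which the values of the extension to the algebraic closure
  are taken. Leaving it arbitrary in an assumption amounts to asking for some extension whatsoever.
\<close>

definition dense_in_alg_closure :: "'w itself \<Rightarrow> 'g ogroup \<Rightarrow> ('k::field \<Rightarrow> 'g ext) \<Rightarrow> bool" where
  "dense_in_alg_closure (_ :: 'w itself) G v0 \<longleftrightarrow>
     (\<exists>(H, \<iota>, v) \<in> (extensions to_ac G v0 :: ('g, 'w, 'k alg_closure) extension set).
        \<forall>a. \<forall>\<alpha>\<in>carrier H. \<exists>c. ext_less H (Fin \<alpha>) (v (a - to_ac c)))"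


section \<open>The rational function field\<close>

definition const_fract :: "'k::field \<Rightarrow> 'k poly fract" where
  "const_fract c = to_fract [:c:]"

definition var_fract :: "'k::field poly fract" where
  "var_fract = to_fract [:0, 1:]"

end

theory Submission
  imports Defs
begin

text \<open>
  All elements of a value group are values of field elements, so everything that has to be said
  about a valuation \<open>v\<close> can be said in terms of the relation \<open>v b \<le> v a\<close> on the field, written
  \<open>a \<preceq> b\<close> and read as \<open>\<bar>a\<bar> \<le> \<bar>b\<bar>\<close>. Two extensions of \<open>v\<^sub>0\<close> are equivalent over \<open>v\<^sub>0\<close> if and only if
  they have the same relation (\<open>val_le_imp_equivalent\<close>, \<open>equivalent_imp_val_le\<close>), each relation
  with the formal properties of an absolute value comes from a valuation (\<open>valuative_extension\<close>),
  and on a field of fractions the relation is determined on the ring. So extensions of \<open>v\<^sub>0\<close> to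
  \<open>K(x)\<close> become relations on \<open>K[x]\<close>, and the approximation type of \<open>x\<close> records exactly how the
  elements \<open>x - c\<close> compare with constants. An algebraically closed \<open>K\<close> lies dense in its algebraic
  closure, for it equals it; hence only density is used from then on.

  Uniqueness (\<open>extension_pair.relations_eq\<close>). Density makes the value group of \<open>K\<close> divisible, and
  therefore the comparisons of the \<open>x - c\<close> with constants determine all comparisons between
  polynomials that split over \<open>K\<close>. If \<open>\<bar>x\<bar>\<close> exceeds all constants, each polynomial has the absolute
  value of its leading term. Otherwise a polynomial \<open>f\<close> is approximated by split polynomials, because
  coefficients depend continuously on roots and roots can be approximated from \<open>K\<close>; this settles
  every \<open>f\<close> whose absolute value is bounded below by a nonzero constant. The remaining \<open>f\<close> form a
  principal ideal \<open>(p)\<close> of \<open>K[x]\<close>, the same for both extensions, and an induction on the degree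
  divides by \<open>p\<close>. This ideal may be nonzero: \<open>x\<close> may be a limit of elements of \<open>K\<close> which converge to
  a root of \<open>p\<close> outside \<open>K\<close>.

  Existence (\<open>nest.ex_realizes\<close>). If \<open>v\<^sub>0\<close> is nontrivial, take an ultrafilter on \<open>K\<close> that contains all
  balls of the given approximation type and the complements of all other balls, and let
  \<open>\<bar>f\<bar> \<le> \<bar>g\<bar>\<close> mean that \<open>\<bar>f(d)\<bar> \<le> \<bar>g(d)\<bar>\<close> for almost all \<open>d\<close>. The ultrafilter exists
  because neither \<open>K\<close> nor a ball is a finite union of balls properly contained in it: the residue field is infinite (\<open>closed_ball_not_covered\<close>) and the
  value group is dense (\<open>value_between\<close>). If \<open>v\<^sub>0\<close> is trivial, there are only three kinds of
  nontrivial approximation types, which belong to the valuation at infinity, the trivial valuation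
  and the valuations at the points of \<open>K\<close>.
\<close>

section \<open>Valuations as relations on a ring\<close>

text \<open>
  Think of \<open>a \<preceq> b\<close> as \<open>\<bar>a\<bar> \<le> \<bar>b\<bar>\<close> for a non-archimedean absolute value, that is, as \<open>v b \<le> v a\<close> for the
  additive valuation. The domain is an integral domain since the relation is used both on
  fields and on rings of polynomials.
\<close>

locale valuative =
  fixes below :: "'a::idom \<Rightarrow> 'a \<Rightarrow> bool" (infix "\<preceq>" 50)
  assumes total: "a \<preceq> b \<or> b \<preceq> a"
    and trans: "a \<preceq> b \<Longrightarrow> b \<preceq> c \<Longrightarrow> a \<preceq> c"
    and zero_le: "0 \<preceq> a"
    and le_zero: "a \<preceq> 0 \<Longrightarrow> a = 0"
    and mult_right: "c \<noteq> 0 \<Longrightarrow> a * c \<preceq> b * c \<longleftrightarrow> a \<preceq> b"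
    and add_le: "a \<preceq> c \<Longrightarrow> b \<preceq> c \<Longrightarrow> a + b \<preceq> c"
begin

definition lt :: "'a \<Rightarrow> 'a \<Rightarrow> bool" (infix "\<prec>" 50) where
  "a \<prec> b \<longleftrightarrow> \<not> b \<preceq> a"

definition same :: "'a \<Rightarrow> 'a \<Rightarrow> bool" (infix "\<asymp>" 50) where
  "a \<asymp> b \<longleftrightarrow> a \<preceq> b \<and> b \<preceq> a"

lemma refl [simp]: "a \<preceq> a"
  using total by blast

lemma le_zero_iff [simp]: "a \<preceq> 0 \<longleftrightarrow> a = 0"
  using le_zero by auto

lemma lt_imp_le: "a \<prec> b \<Longrightarrow> a \<preceq> b"
  using total lt_def by blast

lemma lt_zero [simp]: "0 \<prec> a \<longleftrightarrow> a \<noteq> 0"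
  by (simp add: lt_def)

lemma not_lt: "\<not> a \<prec> b \<longleftrightarrow> b \<preceq> a"
  by (simp add: lt_def)

lemma lt_le_trans: "a \<prec> b \<Longrightarrow> b \<preceq> c \<Longrightarrow> a \<prec> c"
  unfolding lt_def using trans by blast

lemma le_lt_trans: "a \<preceq> b \<Longrightarrow> b \<prec> c \<Longrightarrow> a \<prec> c"
  unfolding lt_def using trans by blast

lemma same_refl [simp]: "a \<asymp> a"
  by (simp add: same_def)

lemma same_sym: "a \<asymp> b \<Longrightarrow> b \<asymp> a"
  by (simp add: same_def)

lemma same_trans: "a \<asymp> b \<Longrightarrow> b \<asymp> c \<Longrightarrow> a \<asymp> c"
  unfolding same_def using trans by blast

lemma same_le: "a \<asymp> a' \<Longrightarrow> b \<asymp> b' \<Longrightarrow> a \<preceq> b \<longleftrightarrow> a' \<preceq> b'"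
  unfolding same_def using trans by blast

lemma same_lt: "a \<asymp> a' \<Longrightarrow> b \<asymp> b' \<Longrightarrow> a \<prec> b \<longleftrightarrow> a' \<prec> b'"
  unfolding lt_def using same_le by blast

lemma same_zero_iff [simp]: "a \<asymp> 0 \<longleftrightarrow> a = 0" "0 \<asymp> a \<longleftrightarrow> a = 0"
  using zero_le by (auto simp: same_def)

lemma mult_left: "c \<noteq> 0 \<Longrightarrow> c * a \<preceq> c * b \<longleftrightarrow> a \<preceq> b"
  using mult_right[of c a b] by (simp add: mult.commute)

lemma mult_mono:
  assumes "a \<preceq> b" "c \<preceq> d"
  shows "a * c \<preceq> b * d"
proof -
  have "a * c \<preceq> b * c" using assms(1) mult_right zero_le by (cases "c = 0") auto
  moreover have "b * c \<preceq> b * d" using assms(2) mult_left zero_le by (cases "b = 0") auto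
  ultimately show ?thesis by (rule trans)
qed

lemma mult_same: "a \<asymp> b \<Longrightarrow> c \<asymp> d \<Longrightarrow> a * c \<asymp> b * d"
  unfolding same_def using mult_mono by blast

lemma mult_lt_le:
  assumes "a \<prec> b" "c \<preceq> d" "d \<noteq> 0"
  shows "a * c \<prec> b * d"
proof -
  have "a * c \<preceq> a * d" using assms(2) by (intro mult_mono) auto
  moreover have "a * d \<prec> b * d" using assms(1,3) mult_right by (simp add: lt_def)
  ultimately show ?thesis by (rule le_lt_trans)
qed

text \<open>
  Whichever way \<open>1\<close> and \<open>- 1\<close> compare, multiplication by \<open>- 1\<close> yields the reverse comparison.
\<close>

lemma minus_same [simp]: "- a \<asymp> a"
proof -
  have "- 1 \<asymp> 1"
  proof -
    have "1 \<preceq> - 1 \<longleftrightarrow> - 1 \<preceq> 1" using mult_right[of "-1" 1 "-1"] by simp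
    then show ?thesis using total[of 1 "-1"] by (auto simp: same_def)
  qed
  then have "- 1 * a \<asymp> 1 * a" by (rule mult_same) simp
  then show ?thesis by simp
qed

lemma minus_le [simp]: "- a \<preceq> b \<longleftrightarrow> a \<preceq> b" "b \<preceq> - a \<longleftrightarrow> b \<preceq> a"
  using same_le[of "-a" a b b] same_le[of b b "-a" a] by auto

lemma minus_lt [simp]: "- a \<prec> b \<longleftrightarrow> a \<prec> b" "b \<prec> - a \<longleftrightarrow> b \<prec> a"
  by (auto simp: lt_def)

lemma diff_le: "a \<preceq> c \<Longrightarrow> b \<preceq> c \<Longrightarrow> a - b \<preceq> c"
  using add_le[of a c "-b"] by simp

lemma diff_commute_le: "a - b \<preceq> c \<longleftrightarrow> b - a \<preceq> c"
  using minus_le(1)[of "a - b" c] by simp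

lemma diff_commute_lt: "a - b \<prec> c \<longleftrightarrow> b - a \<prec> c"
  using minus_lt(1)[of "a - b" c] by simp

lemma add_lt:
  assumes "a \<prec> c" "b \<prec> c"
  shows "a + b \<prec> c"
proof (cases "a \<preceq> b")
  case True
  then have "a + b \<preceq> b" by (intro add_le) auto
  then show ?thesis using assms(2) le_lt_trans by blast
next
  case False
  then have "a + b \<preceq> a" using total by (intro add_le) auto
  then show ?thesis using assms(1) le_lt_trans by blast
qed

lemma diff_lt: "a \<prec> c \<Longrightarrow> b \<prec> c \<Longrightarrow> a - b \<prec> c"
  using add_lt[of a c "-b"] by simp

text \<open>
  The ultrametric principle: the larger summand decides, since it can be recovered from the sum
  by subtracting the smaller one.
\<close>

lemma add_dominant:
  assumes "b \<prec> a"
  shows "a + b \<asymp> a"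
proof -
  have "a + b \<preceq> a" using assms lt_imp_le by (intro add_le) auto
  moreover have "\<not> a + b \<prec> a"
  proof
    assume "a + b \<prec> a"
    then have "(a + b) - b \<prec> a" using assms by (rule diff_lt)
    then show False by (simp add: lt_def)
  qed
  ultimately show ?thesis by (simp add: same_def not_lt)
qed

lemma close_same:
  assumes "a - b \<prec> a"
  shows "b \<asymp> a"
  using add_dominant[of "b - a" a] assms diff_commute_lt by simp

lemma sum_lt:
  assumes "\<And>i. i \<in> I \<Longrightarrow> f i \<prec> c" "c \<noteq> 0"
  shows "sum f I \<prec> c"
proof (cases "finite I")
  case True
  then show ?thesis using assms by induction (auto intro: add_lt)
qed (use assms in simp)

lemma power_mono: "a \<preceq> b \<Longrightarrow> a ^ n \<preceq> b ^ n"
  by (induction n) (auto intro: mult_mono)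

lemma power_strict_mono:
  assumes "a \<prec> b" "n > 0"
  shows "a ^ n \<prec> b ^ n"
  using assms(2)
proof (induction n rule: nat_induct_non_zero)
  case (Suc n)
  have "b \<noteq> 0" using assms(1) by (auto simp: lt_def zero_le)
  then show ?case using Suc mult_lt_le[OF assms(1) lt_imp_le[OF Suc.IH]] by simp
qed (use assms in simp)

lemma power_le_iff: "n > 0 \<Longrightarrow> a ^ n \<preceq> b ^ n \<longleftrightarrow> a \<preceq> b"
  using power_mono power_strict_mono lt_def by metis

lemma one_le_power: "1 \<preceq> a \<Longrightarrow> 1 \<preceq> a ^ n"
  using power_mono[of 1 a n] by simp

lemma power_increasing:
  assumes "1 \<preceq> a" "m \<le> n"
  shows "a ^ m \<preceq> a ^ n"
proof -
  have "1 * a ^ m \<preceq> a ^ (n - m) * a ^ m"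
    using assms(1) by (intro mult_mono one_le_power) auto
  also have "a ^ (n - m) * a ^ m = a ^ n" using assms(2) by (simp flip: power_add)
  finally show ?thesis by simp
qed

end

text \<open>
  Serves to restrict a relation from \<open>K(x)\<close> to \<open>K[x]\<close>, and to carry it from an algebraically
  closed \<open>K\<close> to the isomorphic field \<open>K alg_closure\<close>.
\<close>

lemma (in valuative) pullback:
  fixes i :: "'b::idom \<Rightarrow> 'a"
  assumes "\<And>a. i a = 0 \<longleftrightarrow> a = 0" "\<And>a b. i (a * b) = i a * i b" "\<And>a b. i (a + b) = i a + i b"
  shows "valuative (\<lambda>a b. i a \<preceq> i b)"
proof -
  have z: "i 0 = 0" using assms(1) by blast
  then show ?thesis
    by unfold_locales (use total trans zero_le mult_right add_le assms in \<open>auto simp: z assms\<close>)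
qed

section \<open>Passage to the field of fractions\<close>

definition fract_le :: "('a::idom \<Rightarrow> 'a \<Rightarrow> bool) \<Rightarrow> 'a fract \<Rightarrow> 'a fract \<Rightarrow> bool" where
  "fract_le below u w \<longleftrightarrow> (\<exists>a b c d. b \<noteq> 0 \<and> d \<noteq> 0 \<and> u = Fraction_Field.Fract a b \<and>
     w = Fraction_Field.Fract c d \<and> below (a * d) (c * b))"

context valuative
begin

lemma fract_le_Fract:
  assumes "b \<noteq> 0" "d \<noteq> 0"
  shows "fract_le below (Fraction_Field.Fract a b) (Fraction_Field.Fract c d) \<longleftrightarrow> a * d \<preceq> c * b"
proof
  assume "fract_le below (Fraction_Field.Fract a b) (Fraction_Field.Fract c d)"
  then obtain a' b' c' d' where *: "b' \<noteq> 0" "d' \<noteq> 0" "Fraction_Field.Fract a b = Fraction_Field.Fract a' b'"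
    "Fraction_Field.Fract c d = Fraction_Field.Fract c' d'" "a' * d' \<preceq> c' * b'"
    by (auto simp: fract_le_def)
  have eq: "a * b' = a' * b" "c * d' = c' * d" using * assms by (auto simp: eq_fract)
  have "(a * d) * (b' * d') = (a' * d') * (b * d)"
    using arg_cong[OF eq(1), of "\<lambda>t. t * (d * d')"] by (simp add: ac_simps)
  moreover have "(c * b) * (b' * d') = (c' * b') * (b * d)"
    using arg_cong[OF eq(2), of "\<lambda>t. t * (b * b')"] by (simp add: ac_simps)
  ultimately have "a * d \<preceq> c * b \<longleftrightarrow> (a' * d') * (b * d) \<preceq> (c' * b') * (b * d)"
    using mult_right[of "b' * d'" "a * d" "c * b"] *(1,2) by (metis mult_eq_0_iff)
  then show "a * d \<preceq> c * b" using assms mult_right[of "b * d"] *(5) by simp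
qed (use assms in \<open>auto simp: fract_le_def\<close>)

lemma valuative_fract: "valuative (fract_le below)"
proof
  fix u w :: "'a fract"
  show "fract_le below u w \<or> fract_le below w u"
    by (cases u; cases w) (use total in \<open>auto simp: fract_le_Fract\<close>)
  show "fract_le below 0 u"
    by (cases u) (auto simp: Zero_fract_def fract_le_Fract zero_le)
  show "u = 0" if "fract_le below u 0"
    using that by (cases u) (auto simp: Zero_fract_def fract_le_Fract eq_fract)
next
  fix u w z :: "'a fract"
  assume uw: "fract_le below u w" "fract_le below w z"
  obtain a b c d e f where *: "u = Fraction_Field.Fract a b" "w = Fraction_Field.Fract c d"
    "z = Fraction_Field.Fract e f" "b \<noteq> 0" "d \<noteq> 0" "f \<noteq> 0"
    by (cases u; cases w; cases z) auto
  have "a * d * f \<preceq> c * b * f" "c * f * b \<preceq> e * d * b"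
    using uw * mult_right by (auto simp: fract_le_Fract)
  then have "a * f * d \<preceq> e * b * d"
    using trans by (metis (no_types, lifting) mult.assoc mult.commute)
  then show "fract_le below u z" using * mult_right by (auto simp: fract_le_Fract)
next
  fix u w z :: "'a fract" assume "z \<noteq> 0"
  moreover obtain a b c d e f where *: "u = Fraction_Field.Fract a b" "w = Fraction_Field.Fract c d"
    "z = Fraction_Field.Fract e f" "b \<noteq> 0" "d \<noteq> 0" "f \<noteq> 0"
    by (cases u; cases w; cases z) auto
  ultimately have "e \<noteq> 0" by (auto simp: Zero_fract_def eq_fract)
  moreover have "a * e * (d * f) = a * d * (e * f)" "c * e * (b * f) = c * b * (e * f)"
    by (auto simp: algebra_simps)
  ultimately show "fract_le below (u * z) (w * z) \<longleftrightarrow> fract_le below u w"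
    using * mult_right[of "e * f" "a * d" "c * b"]
    by (simp only: fract_le_Fract mult_fract mult_eq_0_iff simp_thms)
next
  fix u w z :: "'a fract"
  assume uw: "fract_le below u z" "fract_le below w z"
  obtain a b c d e f where *: "u = Fraction_Field.Fract a b" "w = Fraction_Field.Fract c d"
    "z = Fraction_Field.Fract e f" "b \<noteq> 0" "d \<noteq> 0" "f \<noteq> 0"
    by (cases u; cases w; cases z) auto
  have "a * f * d \<preceq> e * b * d" "c * f * b \<preceq> e * d * b"
    using uw * mult_right by (auto simp: fract_le_Fract)
  then have "a * f * d + c * f * b \<preceq> e * b * d" by (intro add_le) (auto simp: ac_simps)
  moreover have "a * f * d + c * f * b = (a * d + c * b) * f" by (simp add: algebra_simps)
  ultimately show "fract_le below (u + w) z" using * by (simp add: fract_le_Fract mult.assoc)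
qed

end

lemma fract_le_to_fract:
  assumes "valuative below"
  shows "fract_le below (to_fract a) (to_fract b) \<longleftrightarrow> below a b"
  using valuative.fract_le_Fract[OF assms, of 1 1 a b] by (simp add: to_fract_def)

text \<open>
  Multiplying two fractions by a common denominator does not change how they compare.
\<close>

lemma valuative_fract_eqI:
  fixes r s :: "'a::idom fract \<Rightarrow> 'a fract \<Rightarrow> bool"
  assumes r: "valuative r" and s: "valuative s"
    and eq: "\<And>a b. r (to_fract a) (to_fract b) \<longleftrightarrow> s (to_fract a) (to_fract b)"
  shows "r u w \<longleftrightarrow> s u w"
proof -
  obtain a b c d where *: "u = Fraction_Field.Fract a b" "w = Fraction_Field.Fract c d" "b \<noteq> 0" "d \<noteq> 0"
    by (cases u; cases w) auto
  define z where "z = to_fract (b * d)"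
  have z: "z \<noteq> 0" "u * z = to_fract (a * d)" "w * z = to_fract (c * b)"
    using * by (auto simp: z_def to_fract_def Zero_fract_def eq_fract)
  show ?thesis
    using valuative.mult_right[OF r z(1), of u w] valuative.mult_right[OF s z(1), of u w]
    unfolding z(2,3) eq by simp
qed

section \<open>Valuations up to equivalence are relations\<close>
text \<open>
  The order is reversed: additive valuations are small where absolute values are large.
\<close>

definition val_le :: "'g ogroup \<Rightarrow> ('k::field \<Rightarrow> 'g ext) \<Rightarrow> 'k \<Rightarrow> 'k \<Rightarrow> bool" where
  "val_le G v a b \<longleftrightarrow> ext_le G (v b) (v a)"

lemma ordered_ab_group_order:
  assumes "ordered_ab_group G"
  shows "(a, b) \<in> ole G \<Longrightarrow> a \<in> carrier G \<and> b \<in> carrier G"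
    and "a \<in> carrier G \<Longrightarrow> (a, a) \<in> ole G"
    and "(a, b) \<in> ole G \<Longrightarrow> (b, c) \<in> ole G \<Longrightarrow> (a, c) \<in> ole G"
    and "(a, b) \<in> ole G \<Longrightarrow> (b, a) \<in> ole G \<Longrightarrow> a = b"
    and "a \<in> carrier G \<Longrightarrow> b \<in> carrier G \<Longrightarrow> (a, b) \<in> ole G \<or> (b, a) \<in> ole G"
proof -
  have lin: "linear_order_on (carrier G) (ole G)" using assms by (simp add: ordered_ab_group_def ordered_ab_group_axioms_def)
  then have r: "refl_on (carrier G) (ole G)" "trans (ole G)" "antisym (ole G)" "total_on (carrier G) (ole G)"
    "ole G \<subseteq> carrier G \<times> carrier G"
    by (auto simp: order_on_defs)
  show "(a, b) \<in> ole G \<Longrightarrow> a \<in> carrier G \<and> b \<in> carrier G" using r by auto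
  show 1: "a \<in> carrier G \<Longrightarrow> (a, a) \<in> ole G" for a using r by (auto simp: refl_on_def)
  show "(a, b) \<in> ole G \<Longrightarrow> (b, c) \<in> ole G \<Longrightarrow> (a, c) \<in> ole G" using r by (meson transD)
  show "(a, b) \<in> ole G \<Longrightarrow> (b, a) \<in> ole G \<Longrightarrow> a = b" using r by (meson antisymD)
  show "a \<in> carrier G \<Longrightarrow> b \<in> carrier G \<Longrightarrow> (a, b) \<in> ole G \<or> (b, a) \<in> ole G"
    using r 1 by (cases "a = b") (auto simp: total_on_def)
qed

lemma ext_order:
  assumes "ordered_ab_group G"
  shows "x \<in> ext_carrier G \<Longrightarrow> ext_le G x x"
    and "ext_le G x y \<Longrightarrow> ext_le G y z \<Longrightarrow> ext_le G x z"
    and "ext_le G x y \<Longrightarrow> ext_le G y x \<Longrightarrow> x = y"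
    and "x \<in> ext_carrier G \<Longrightarrow> y \<in> ext_carrier G \<Longrightarrow> ext_le G x y \<or> ext_le G y x"
proof -
  note o = ordered_ab_group_order[OF assms]
  show "x \<in> ext_carrier G \<Longrightarrow> ext_le G x x" using o(2) by (cases x) (auto simp: ext_carrier_def)
  show "ext_le G x y \<Longrightarrow> ext_le G y z \<Longrightarrow> ext_le G x z"
    by (cases x; cases y; cases z) (auto intro: o(3))
  show "ext_le G x y \<Longrightarrow> ext_le G y x \<Longrightarrow> x = y"
    by (cases x; cases y) (auto intro: o(4))
  show "x \<in> ext_carrier G \<Longrightarrow> y \<in> ext_carrier G \<Longrightarrow> ext_le G x y \<or> ext_le G y x"
    using o(5) by (cases x; cases y) (auto simp: ext_carrier_def)
qed

lemma ext_less_iff: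
  assumes "ordered_ab_group G" "x \<in> ext_carrier G" "y \<in> ext_carrier G"
  shows "ext_less G x y \<longleftrightarrow> \<not> ext_le G y x"
  using ext_order[OF assms(1)] assms(2,3) unfolding ext_less_def by metis

lemma ext_add_le_iff:
  assumes "ordered_ab_group G" "x \<in> ext_carrier G" "y \<in> ext_carrier G" "c \<in> carrier G"
  shows "ext_le G (ext_add G x (Fin c)) (ext_add G y (Fin c)) \<longleftrightarrow> ext_le G x y"
proof -
  interpret ordered_ab_group G by fact
  have *: "(a \<otimes>\<^bsub>G\<^esub> c, b \<otimes>\<^bsub>G\<^esub> c) \<in> ole G \<longleftrightarrow> (a, b) \<in> ole G" if ab: "a \<in> carrier G" "b \<in> carrier G" for a b
  proof
    assume "(a \<otimes>\<^bsub>G\<^esub> c, b \<otimes>\<^bsub>G\<^esub> c) \<in> ole G"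
    then have "(inv\<^bsub>G\<^esub> c \<otimes>\<^bsub>G\<^esub> (a \<otimes>\<^bsub>G\<^esub> c), inv\<^bsub>G\<^esub> c \<otimes>\<^bsub>G\<^esub> (b \<otimes>\<^bsub>G\<^esub> c)) \<in> ole G" using assms(4) by (intro translate) auto
    then show "(a, b) \<in> ole G" using ab assms(4)
      by (metis inv_closed inv_solve_left m_closed m_comm)
  next
    assume "(a, b) \<in> ole G"
    then have "(c \<otimes>\<^bsub>G\<^esub> a, c \<otimes>\<^bsub>G\<^esub> b) \<in> ole G" using assms(4) by (rule translate)
    then show "(a \<otimes>\<^bsub>G\<^esub> c, b \<otimes>\<^bsub>G\<^esub> c) \<in> ole G" using ab assms(4) by (simp add: m_comm)
  qed
  show ?thesis using assms * by (cases x; cases y) (auto simp: ext_carrier_def)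
qed

lemma valuation_finite:
  assumes "valuation G v"
  shows "a \<noteq> 0 \<Longrightarrow> \<exists>\<gamma>\<in>carrier G. v a = Fin \<gamma>" "\<gamma> \<in> carrier G \<Longrightarrow> \<exists>a. a \<noteq> 0 \<and> v a = Fin \<gamma>"
    "v a = Infty \<longleftrightarrow> a = 0"
proof -
  have im: "v ` (UNIV - {0}) = Fin ` carrier G" and z: "v 0 = Infty" using assms by (auto simp: valuation_def)
  show 1: "\<exists>\<gamma>\<in>carrier G. v a = Fin \<gamma>" if "a \<noteq> 0" for a
  proof -
    have "v a \<in> v ` (UNIV - {0})" using that by blast
    then show ?thesis unfolding im by blast
  qed
  show "\<exists>a. a \<noteq> 0 \<and> v a = Fin \<gamma>" if "\<gamma> \<in> carrier G"
  proof -
    have "Fin \<gamma> \<in> v ` (UNIV - {0})" using that unfolding im by blast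
    then show ?thesis by force
  qed
  show "v a = Infty \<longleftrightarrow> a = 0" using 1[of a] z by force
qed

lemma ext_carrier_valuation:
  assumes "valuation G v" "\<gamma> \<in> ext_carrier G"
  obtains a where "v a = \<gamma>"
  using assms valuation_finite(2)[OF assms(1)] valuation_finite(3)[OF assms(1)] unfolding ext_carrier_def by blast

lemma valuative_valuation:
  assumes "valuation G v"
  shows "valuative (val_le G v)"
proof -
  have G: "ordered_ab_group G" and mul: "v (a * b) = ext_add G (v a) (v b)"
    and ultra: "ext_le G (ext_min G (v a) (v b)) (v (a + b))" for a b
    using assms by (auto simp: valuation_def)
  note o = ext_order[OF G] and mem = valuation_in_ext_carrier[OF assms] and fin = valuation_finite[OF assms]
  show ?thesis
  proof
    fix a b c
    show "val_le G v a b \<or> val_le G v b a" using o(4) mem by (auto simp: val_le_def)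
    show "val_le G v a b \<Longrightarrow> val_le G v b c \<Longrightarrow> val_le G v a c" using o(2) by (auto simp: val_le_def)
    show "val_le G v 0 a" using fin(3)[of 0] by (simp add: val_le_def)
    show "val_le G v a 0 \<Longrightarrow> a = 0" using fin(3)[of 0] fin(3)[of a] by (cases "v a") (auto simp: val_le_def)
    show "val_le G v (a * c) (b * c) \<longleftrightarrow> val_le G v a b" if "c \<noteq> 0"
      using fin(1)[OF that] ext_add_le_iff[OF G mem mem] by (auto simp: val_le_def mul)
    show "val_le G v (a + b) c" if "val_le G v a c" "val_le G v b c"
    proof -
      have "ext_le G (v c) (ext_min G (v a) (v b))" using that by (simp add: val_le_def ext_min_def)
      then show ?thesis using ultra o(2) unfolding val_le_def by blast
    qed
  qed
qed

lemma map_ext_le: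
  assumes "order_embedding G H \<iota>" "x \<in> ext_carrier G" "y \<in> ext_carrier G"
  shows "ext_le H (map_ext \<iota> x) (map_ext \<iota> y) \<longleftrightarrow> ext_le G x y"
  using assms by (auto simp: order_embedding_def ext_carrier_def)

lemma extension_val_le:
  assumes "valuation G v0" "(H, \<iota>, v) \<in> extensions i G v0"
  shows "valuative (val_le H v)" "val_le H v (i a) (i b) \<longleftrightarrow> val_le G v0 a b"
proof -
  have E: "valuation H v" "order_embedding G H \<iota>" "\<And>a. v (i a) = map_ext \<iota> (v0 a)"
    using assms(2) by (auto simp: extensions_def)
  then show "valuative (val_le H v)" by (intro valuative_valuation)
  show "val_le H v (i a) (i b) \<longleftrightarrow> val_le G v0 a b"
    using map_ext_le[OF E(2)] valuation_in_ext_carrier[OF assms(1)] by (simp add: val_le_def E(3))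
qed

text \<open>
  The isomorphism of value groups can only send \<open>v f\<close> to \<open>v' f\<close>. That the relations agree is what
  makes this well defined, injective and order preserving. It fixes the value group of \<open>v\<^sub>0\<close> since
  that group consists of values of constants.
\<close>

lemma val_le_imp_equivalent:
  assumes v0: "valuation G v0" and E: "(H, \<iota>, v) \<in> extensions i G v0" and E': "(H', \<iota>', v') \<in> extensions i G v0"
    and eq: "val_le H v = val_le H' v'"
  shows "equivalent_over G (H, \<iota>, v) (H', \<iota>', v')"
proof -
  have v: "valuation H v" "order_embedding G H \<iota>" "\<And>a. v (i a) = map_ext \<iota> (v0 a)"
    using E by (auto simp: extensions_def)
  have v': "valuation H' v'" "order_embedding G H' \<iota>'" "\<And>a. v' (i a) = map_ext \<iota>' (v0 a)"
    using E' by (auto simp: extensions_def)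
  have H: "ordered_ab_group H" "ordered_ab_group H'"
    and mul: "\<And>a b. v (a * b) = ext_add H (v a) (v b)" "\<And>a b. v' (a * b) = ext_add H' (v' a) (v' b)"
    using v(1) v'(1) by (auto simp: valuation_def)
  note fin = valuation_finite[OF v(1)] and fin' = valuation_finite[OF v'(1)]
  have le: "ext_le H (v f) (v g) \<longleftrightarrow> ext_le H' (v' f) (v' g)" for f g
    using eq unfolding val_le_def by meson
  have veq: "v f = v g \<longleftrightarrow> v' f = v' g" for f g
    using ext_order(1,3)[OF H(1)] ext_order(1,3)[OF H(2)] le
      valuation_in_ext_carrier[OF v(1)] valuation_in_ext_carrier[OF v'(1)] by metis
  define r where "r h = (SOME f. v f = Fin h)" for h
  define \<sigma> where "\<sigma> h = (THE h'. v' (r h) = Fin h')" for h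
  have r: "v (r h) = Fin h" if "h \<in> carrier H" for h
    unfolding r_def using fin(2)[OF that] by (metis (mono_tags) someI_ex)
  have \<sigma>: "v' f = Fin (\<sigma> h) \<and> \<sigma> h \<in> carrier H'" if "v f = Fin h" "h \<in> carrier H" for f h
  proof -
    have "v' f = v' (r h)" using r that veq by metis
    moreover have "f \<noteq> 0" using that(1) fin(3)[of f] by auto
    ultimately obtain h' where "h' \<in> carrier H'" "v' f = Fin h'" "v' (r h) = Fin h'" using fin'(1) by metis
    then show ?thesis by (simp add: \<sigma>_def)
  qed
  have map: "v' f = map_ext \<sigma> (v f)" for f
    using fin(1,3)[of f] fin'(3)[of f] \<sigma> by (cases "f = 0") auto
  have hom: "\<sigma> \<in> hom H H'"
  proof (rule homI)
    fix h k assume hk: "h \<in> carrier H" "k \<in> carrier H"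
    show "\<sigma> h \<in> carrier H'" using \<sigma> r hk by blast
    have "v (r h * r k) = Fin (h \<otimes>\<^bsub>H\<^esub> k)" using r hk by (simp add: mul)
    then have "v' (r h * r k) = Fin (\<sigma> (h \<otimes>\<^bsub>H\<^esub> k))" unfolding map by simp
    moreover have "v' (r h) = Fin (\<sigma> h)" "v' (r k) = Fin (\<sigma> k)" using r \<sigma> hk by auto
    ultimately show "\<sigma> (h \<otimes>\<^bsub>H\<^esub> k) = \<sigma> h \<otimes>\<^bsub>H'\<^esub> \<sigma> k" by (simp add: mul)
  qed
  have emb: "(h, k) \<in> ole H \<longleftrightarrow> (\<sigma> h, \<sigma> k) \<in> ole H'" if "h \<in> carrier H" "k \<in> carrier H" for h k
    using le[of "r h" "r k"] r that by (simp add: map)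
  have "bij_betw \<sigma> (carrier H) (carrier H')"
    unfolding bij_betw_def
  proof
    show "inj_on \<sigma> (carrier H)"
      using emb ordered_ab_group_order(2,4)[OF H(1)] by (metis (no_types, lifting) inj_onI)
    show "\<sigma> ` carrier H = carrier H'"
    proof (intro equalityI subsetI)
      fix h' assume "h' \<in> carrier H'"
      then obtain f where f: "f \<noteq> 0" "v' f = Fin h'" using fin'(2) by blast
      then obtain h where "h \<in> carrier H" "v f = Fin h" using fin(1) by blast
      then show "h' \<in> \<sigma> ` carrier H" using f \<sigma> by force
    qed (use hom in \<open>auto simp: hom_def\<close>)
  qed
  then have iso: "\<sigma> \<in> iso H H'" using hom by (simp add: iso_def)
  have "\<sigma> (\<iota> \<gamma>) = \<iota>' \<gamma>" if \<gamma>: "\<gamma> \<in> carrier G" for \<gamma>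
  proof -
    obtain a where "v0 a = Fin \<gamma>" using valuation_finite(2)[OF v0 \<gamma>] by blast
    then show ?thesis using map[of "i a"] v(3)[of a] v'(3)[of a] by simp
  qed
  then show ?thesis using iso hom emb map by (auto simp: order_embedding_def)
qed

lemma equivalent_imp_val_le:
  assumes E: "(H, \<iota>, v) \<in> extensions i G v0" and eq: "equivalent_over G (H, \<iota>, v) (H', \<iota>', v')"
  shows "val_le H v = val_le H' v'"
proof -
  have v: "valuation H v" using E by (auto simp: extensions_def)
  obtain \<sigma> where \<sigma>: "order_embedding H H' \<sigma>" "\<forall>f. v' f = map_ext \<sigma> (v f)"
    using eq by auto
  then show ?thesis
    using map_ext_le[OF \<sigma>(1)] valuation_in_ext_carrier[OF v] by (simp add: val_le_def fun_eq_iff)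
qed

text \<open>
  Conversely a relation on a field gives a valuation: its value group consists of the classes of
  nonzero elements of equal absolute value. This is the quotient of the multiplicative group by the
  units of the valuation ring.
\<close>

locale valuative_field = valuative below for below :: "'l::field \<Rightarrow> 'l \<Rightarrow> bool" (infix "\<preceq>" 50)
begin

definition cls :: "'l \<Rightarrow> 'l set" where
  "cls f = {g. g \<asymp> f}"

definition rep :: "'l set \<Rightarrow> 'l" where
  "rep C = (SOME f. f \<in> C)"

definition class_group :: "'l set ogroup" where
  "class_group = \<lparr>carrier = cls ` (UNIV - {0}), monoid.mult = (\<lambda>C D. cls (rep C * rep D)),
     monoid.one = cls 1, ole = {(cls f, cls g) | f g. f \<noteq> 0 \<and> g \<noteq> 0 \<and> g \<preceq> f}\<rparr>"

lemma cls_eq_iff: "cls f = cls g \<longleftrightarrow> f \<asymp> g"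
  unfolding cls_def using same_refl same_sym same_trans by blast

lemma rep_cls: "rep (cls f) \<asymp> f"
proof -
  have "f \<in> cls f" by (simp add: cls_def)
  then have "rep (cls f) \<in> cls f" unfolding rep_def by (rule someI)
  then show ?thesis by (simp add: cls_def)
qed

lemma class_mult: "cls f \<otimes>\<^bsub>class_group\<^esub> cls g = cls (f * g)"
  using mult_same[OF rep_cls rep_cls] by (simp add: class_group_def cls_eq_iff)

lemma class_le: "f \<noteq> 0 \<Longrightarrow> g \<noteq> 0 \<Longrightarrow> (cls f, cls g) \<in> ole class_group \<longleftrightarrow> g \<preceq> f"
proof
  assume "(cls f, cls g) \<in> ole class_group"
  then obtain f' g' where "cls f = cls f'" "cls g = cls g'" "g' \<preceq> f'" by (auto simp: class_group_def)
  then show "g \<preceq> f" using same_le[of g g' f f'] by (simp add: cls_eq_iff)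
qed (auto simp: class_group_def)

lemma class_carrier: "carrier class_group = cls ` (UNIV - {0})" "\<one>\<^bsub>class_group\<^esub> = cls 1"
  by (auto simp: class_group_def)

lemma ordered_class_group: "ordered_ab_group class_group"
proof (intro ordered_ab_group.intro ordered_ab_group_axioms.intro)
  show "comm_group class_group"
  proof (rule comm_groupI)
    fix C assume "C \<in> carrier class_group"
    then obtain f where f: "f \<noteq> 0" "C = cls f" by (auto simp: class_carrier)
    then have "cls (inverse f) \<otimes>\<^bsub>class_group\<^esub> C = \<one>\<^bsub>class_group\<^esub>" "cls (inverse f) \<in> carrier class_group"
      by (auto simp: class_carrier class_mult)
    then show "\<exists>D\<in>carrier class_group. D \<otimes>\<^bsub>class_group\<^esub> C = \<one>\<^bsub>class_group\<^esub>" by blast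
  qed (auto simp: class_carrier class_mult ac_simps)
  show "linear_order_on (carrier class_group) (ole class_group)"
    unfolding order_on_defs
  proof (intro conjI)
    show "ole class_group \<subseteq> carrier class_group \<times> carrier class_group"
      by (auto simp: class_group_def)
    show "refl_on (carrier class_group) (ole class_group)"
      by (auto simp: refl_on_def class_carrier class_le)
    show "total_on (carrier class_group) (ole class_group)"
      using total by (auto simp: total_on_def class_carrier class_le)
    show "antisym (ole class_group)"
    proof (rule antisymI)
      fix A B assume AB: "(A, B) \<in> ole class_group" "(B, A) \<in> ole class_group"
      then obtain f g where "A = cls f" "B = cls g" "f \<noteq> 0" "g \<noteq> 0"
        by (auto simp: class_group_def)
      then show "A = B" using AB by (simp add: class_le cls_eq_iff same_def)
    qed
    show "Relation.trans (ole class_group)"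
    proof (rule transI)
      fix A B C assume AB: "(A, B) \<in> ole class_group" "(B, C) \<in> ole class_group"
      then obtain f g h where "A = cls f" "B = cls g" "C = cls h" "f \<noteq> 0" "g \<noteq> 0" "h \<noteq> 0"
        by (auto simp: class_group_def)
      then show "(A, C) \<in> ole class_group" using AB trans by (auto simp: class_le)
    qed
  qed
next
  fix A B C assume AB: "(A, B) \<in> ole class_group" and "C \<in> carrier class_group"
  then obtain f g h where "A = cls f" "B = cls g" "C = cls h" "f \<noteq> 0" "g \<noteq> 0" "h \<noteq> 0"
    by (auto simp: class_group_def)
  then show "(C \<otimes>\<^bsub>class_group\<^esub> A, C \<otimes>\<^bsub>class_group\<^esub> B) \<in> ole class_group"
    using AB mult_left by (simp add: class_le class_mult)
qed

definition class_val :: "'l \<Rightarrow> 'l set ext" where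
  "class_val f = (if f = 0 then Infty else Fin (cls f))"

lemma ext_le_class_val: "ext_le class_group (class_val g) (class_val f) \<longleftrightarrow> f \<preceq> g"
  using zero_le by (auto simp: class_val_def class_le)

lemma valuation_class_val: "valuation class_group class_val"
  unfolding valuation_def
proof (intro conjI allI)
  show "class_val ` (UNIV - {0}) = Fin ` carrier class_group"
    by (force simp: class_val_def class_carrier)
  show "class_val (a * b) = ext_add class_group (class_val a) (class_val b)" for a b
    by (simp add: class_val_def class_mult)
  show "ext_le class_group (ext_min class_group (class_val a) (class_val b)) (class_val (a + b))" for a b
    using add_le[of a a b] add_le[of a b b] total[of a b] by (auto simp: ext_min_def ext_le_class_val)
qed (simp_all add: ordered_class_group class_val_def)

lemma val_le_class_val: "val_le class_group class_val f g \<longleftrightarrow> f \<preceq> g"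
  by (simp add: val_le_def ext_le_class_val)

lemma class_extension:
  fixes i :: "'k::field \<Rightarrow> 'l"
  assumes v0: "valuation G v0" and i0: "\<And>a. i a = 0 \<longleftrightarrow> a = 0" and im: "\<And>a b. i (a * b) = i a * i b"
    and le: "\<And>a b. i a \<preceq> i b \<longleftrightarrow> val_le G v0 a b"
  shows "\<exists>\<iota>. (class_group, \<iota>, class_val) \<in> extensions i G v0"
proof -
  note fin = valuation_finite[OF v0]
  define r where "r \<gamma> = (SOME a. v0 a = Fin \<gamma>)" for \<gamma>
  have r: "v0 (r \<gamma>) = Fin \<gamma>" if "\<gamma> \<in> carrier G" for \<gamma>
    unfolding r_def using fin(2)[OF that] by (metis (mono_tags) someI_ex)
  have nz: "i a \<noteq> 0" if "v0 a = Fin \<gamma>" for a \<gamma> using i0 fin(3)[of a] that by auto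
  have same: "i a \<asymp> i b" if "v0 a = v0 b" for a b
    using ext_order(1) v0 valuation_in_ext_carrier[OF v0] that
    by (metis le same_def val_le_def valuation_def)
  define \<iota> where "\<iota> \<gamma> = cls (i (r \<gamma>))" for \<gamma>
  have \<iota>: "cls (i a) = \<iota> \<gamma>" if "v0 a = Fin \<gamma>" "\<gamma> \<in> carrier G" for a \<gamma>
    unfolding \<iota>_def cls_eq_iff using r same that by simp
  have map: "class_val (i a) = map_ext \<iota> (v0 a)" for a
    using fin(1,3)[of a] i0 \<iota>[of a] by (cases "a = 0") (auto simp: class_val_def)
  have "order_embedding G class_group \<iota>"
    unfolding order_embedding_def
  proof (intro conjI ballI homI)
    fix \<gamma> \<delta> assume \<gamma>: "\<gamma> \<in> carrier G" "\<delta> \<in> carrier G"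
    show "\<iota> \<gamma> \<in> carrier class_group" using nz r \<gamma> by (auto simp: \<iota>_def class_carrier)
    have "v0 (r \<gamma> * r \<delta>) = Fin (\<gamma> \<otimes>\<^bsub>G\<^esub> \<delta>)" using r \<gamma> v0 by (simp add: valuation_def)
    moreover have "\<gamma> \<otimes>\<^bsub>G\<^esub> \<delta> \<in> carrier G"
      using v0 \<gamma> by (auto simp: valuation_def ordered_ab_group_def comm_group_def comm_monoid_def intro: monoid.m_closed)
    ultimately show "\<iota> (\<gamma> \<otimes>\<^bsub>G\<^esub> \<delta>) = \<iota> \<gamma> \<otimes>\<^bsub>class_group\<^esub> \<iota> \<delta>"
      using \<iota> by (metis \<iota>_def class_mult im)
    show "(\<gamma>, \<delta>) \<in> ole G \<longleftrightarrow> (\<iota> \<gamma>, \<iota> \<delta>) \<in> ole class_group"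
      using le[of "r \<delta>" "r \<gamma>"] r nz \<gamma> by (simp add: val_le_def \<iota>_def class_le)
  qed
  then have "(class_group, \<iota>, class_val) \<in> extensions i G v0"
    using valuation_class_val map by (simp add: extensions_def)
  then show ?thesis by blast
qed

end

text \<open>
  The classes above are sets of field elements; \<open>extension_in_universe\<close> moves them
  to any type large enough to contain a copy of the field.
\<close>

lemma valuative_extension:
  fixes i :: "'k::field \<Rightarrow> 'l::field" and r :: "'l \<Rightarrow> 'l \<Rightarrow> bool" and e :: "'l \<Rightarrow> 'u"
    and G :: "'g ogroup"
  assumes v0: "valuation G v0" and r: "valuative r" and "\<And>a. i a = 0 \<longleftrightarrow> a = 0" "\<And>a b. i (a * b) = i a * i b"
    and "\<And>a b. r (i a) (i b) \<longleftrightarrow> val_le G v0 a b" and e: "inj e"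
  obtains H and \<iota> :: "'g \<Rightarrow> 'u" and v where "(H, \<iota>, v) \<in> extensions i G v0" "val_le H v = r"
proof -
  interpret valuative_field r using r by (rule valuative_field.intro)
  obtain \<iota> where E: "(class_group, \<iota>, class_val) \<in> extensions i G v0"
    using class_extension[OF v0, of i] assms by blast
  obtain E' :: "('g, 'u, 'l) extension" where E': "E' \<in> extensions i G v0"
    "equivalent_over G (class_group, \<iota>, class_val) E'"
    using extension_in_universe[OF E e] by blast
  obtain H \<iota>' v where EE: "E' = (H, \<iota>', v)" by (cases E')
  have "val_le H v = r"
    using equivalent_imp_val_le[OF E E'(2)[unfolded EE]] val_le_class_val by (auto simp: fun_eq_iff)
  then show thesis using that E'(1) EE by blast
qed

section \<open>Uniqueness of the extension with a given approximation type\<close>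
locale poly_valuative = valuative below for below :: "'k::field poly \<Rightarrow> 'k poly \<Rightarrow> bool" (infix "\<preceq>" 50)
begin

text \<open>
  All powers of \<open>x\<close> up to the \<open>n\<close>-th are bounded by \<open>b ^ n\<close>, since \<open>\<bar>b\<bar> \<ge> 1\<close>.
\<close>

lemma poly_lt:
  assumes x: "[:0, 1:] \<preceq> [:b:]" and b: "1 \<preceq> [:b:]" and deg: "Polynomial.degree h \<le> n"
    and e: "e \<noteq> 0" and co: "\<And>k. [:Polynomial.coeff h k:] \<prec> [:e:]"
  shows "h \<prec> [:e * b ^ n:]"
proof -
  have b0: "b \<noteq> 0" using b by auto
  have "(\<Sum>k\<le>n. [:Polynomial.coeff h k:] * [:0, 1:] ^ k) \<prec> [:e:] * [:b:] ^ n"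
  proof (rule sum_lt)
    fix k assume "k \<in> {..n}"
    then have "[:0, 1:] ^ k \<preceq> [:b:] ^ n"
      using power_mono[OF x, of k] power_increasing[OF b, of k n] trans by auto
    then show "[:Polynomial.coeff h k:] * [:0, 1:] ^ k \<prec> [:e:] * [:b:] ^ n"
      using co b0 by (intro mult_lt_le) auto
  qed (use e b0 in auto)
  also have "(\<Sum>k\<le>n. [:Polynomial.coeff h k:] * [:0, 1:] ^ k) = h"
    using poly_as_sum_of_monoms'[OF deg] by (simp add: monom_altdef)
  finally show ?thesis by (simp add: poly_const_pow mult.commute)
qed

lemma poly_le:
  assumes x: "[:0, 1:] \<preceq> [:b:]"
  shows "\<exists>d. d \<noteq> 0 \<and> h \<preceq> [:d:]"
proof (induction h)
  case 0
  show ?case using zero_le by (intro exI[of _ 1]) auto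
next
  case (pCons a h)
  then obtain d where d: "d \<noteq> 0" "h \<preceq> [:d:]" by blast
  have "[:0, 1:] * h \<preceq> [:b:] * [:d:]" by (intro mult_mono x d)
  then have *: "[:0, 1:] * h \<preceq> [:b * d:]" by (simp add: mult.commute)
  have "\<exists>c. c \<noteq> 0 \<and> [:b * d:] \<preceq> [:c:] \<and> [:a:] \<preceq> [:c:]"
  proof (cases "b * d = 0 \<and> a = 0")
    case True
    then show ?thesis by (intro exI[of _ 1]) (use zero_le in auto)
  next
    case False
    then show ?thesis
      using total[of "[:b * d:]" "[:a:]"] le_zero[of "[:b * d:]"] le_zero[of "[:a:]"] refl
      by (metis pCons_0_0 pCons_eq_0_iff)
  qed
  then obtain c where c: "c \<noteq> 0" "[:b * d:] \<preceq> [:c:]" "[:a:] \<preceq> [:c:]" by blast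
  have "[:a:] + [:0, 1:] * h \<preceq> [:c:]" using c * trans by (intro add_le) blast+
  then show ?case using c(1) by auto
qed

text \<open>
  If \<open>\<bar>x\<bar>\<close> exceeds all constants, then each power of \<open>x\<close> exceeds all constant multiples of the
  preceding one, so no cancellation with the leading term is possible.
\<close>

lemma leading_term:
  assumes x: "\<And>b. [:b:] \<prec> [:0, 1:]" and "f \<noteq> 0"
  shows "f \<asymp> [:Polynomial.lead_coeff f:] * [:0, 1:] ^ Polynomial.degree f"
  using \<open>f \<noteq> 0\<close>
proof (induction f)
  case (pCons a f)
  show ?case
  proof (cases "f = 0")
    case False
    let ?x = "[:0, 1:] :: 'k poly" and ?c = "[:Polynomial.lead_coeff f:]"
    have c: "Polynomial.lead_coeff f \<noteq> 0" using False by simp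
    have "?x * f \<asymp> ?x * (?c * ?x ^ Polynomial.degree f)" using pCons False by (intro mult_same) auto
    then have f: "?x * f \<asymp> ?c * ?x ^ Suc (Polynomial.degree f)" by (simp only: power_Suc ac_simps)
    have "[:a / Polynomial.lead_coeff f:] * ?c \<prec> ?x * ?c"
      using x[of "a / Polynomial.lead_coeff f"] c by (intro mult_lt_le) auto
    then have "[:a:] \<prec> ?c * ?x" using c by simp
    moreover have "1 \<preceq> ?x" using x[of 1] by (auto simp: one_pCons intro: lt_imp_le)
    then have "?x ^ 1 \<preceq> ?x ^ Suc (Polynomial.degree f)" by (rule power_increasing) simp
    then have "?c * ?x \<preceq> ?c * ?x ^ Suc (Polynomial.degree f)" by (intro mult_mono) auto
    ultimately have "[:a:] \<prec> ?c * ?x ^ Suc (Polynomial.degree f)" by (rule lt_le_trans)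
    then have "[:a:] \<prec> ?x * f" using same_lt[OF same_refl f] by blast
    then have "?x * f + [:a:] \<asymp> ?x * f" by (rule add_dominant)
    moreover have "?x * f + [:a:] = pCons a f" by simp
    ultimately show ?thesis using f False same_trans by (metis degree_pCons_eq lead_coeff_pCons(1))
  qed simp
qed simp

end

text \<open>
  A field \<open>K\<close> embedded by \<open>j\<close> as a dense subfield of an algebraically closed field. The relation on
  \<open>K\<close> itself is the one pulled back along \<open>j\<close>.
\<close>

locale dense_valued = valuative below for below :: "'l::alg_closed_field \<Rightarrow> 'l \<Rightarrow> bool" (infix "\<preceq>" 50) +
  fixes j :: "'k::field \<Rightarrow> 'l"
  assumes j_eq_0 [simp]: "j a = 0 \<longleftrightarrow> a = 0"
    and j_1 [simp]: "j 1 = 1"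
    and j_add [simp]: "j (a + b) = j a + j b"
    and j_mult [simp]: "j (a * b) = j a * j b"
    and dense: "y \<noteq> 0 \<Longrightarrow> \<exists>c. x - j c \<prec> y"
begin

lemma j_0 [simp]: "j 0 = 0"
  by simp

lemma j_minus [simp]: "j (- a) = - j a"
  using minus_unique[of "j a" "j (-a)"] j_add[of a "-a"] by simp

lemma j_diff [simp]: "j (a - b) = j a - j b"
  using j_add[of a "-b"] by (simp del: j_add)

lemma j_power [simp]: "j (a ^ n) = j a ^ n"
  by (induction n) auto

lemma j_divide [simp]: "j (a / b) = j a / j b"
proof (cases "b = 0")
  case False
  then have "j (a / b) * j b = j a" by (simp flip: j_mult)
  then show ?thesis using False by (simp add: field_simps)
qed simp

text \<open>
  An element of \<open>K\<close> that is close enough to \<open>a\<close> has the same absolute value: a dense subfield has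
  the same value group.
\<close>

lemma same_value:
  assumes "a \<noteq> 0"
  obtains c where "c \<noteq> 0" "j c \<asymp> a"
proof -
  obtain c where "a - j c \<prec> a" using dense assms by blast
  then have "j c \<asymp> a" by (rule close_same)
  then show thesis using that assms by (metis j_0 same_zero_iff(2))
qed

text \<open>
  The value group of \<open>K\<close> is divisible: take a root in the algebraically closed field and
  approximate it.
\<close>

lemma root_value:
  assumes "n > 0"
  obtains e where "j e ^ n \<asymp> j a"
proof (cases "a = 0")
  case True
  then show thesis using that[of 0] assms by simp
next
  case False
  obtain z where z: "z ^ n = j a" using nth_root_exists assms by blast
  then have "z \<noteq> 0" using False assms by (metis j_eq_0 zero_power)
  then obtain e where "j e \<asymp> z" by (rule same_value)
  then have "j e ^ n \<asymp> z ^ n" using power_mono by (simp add: same_def)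
  then show thesis using that z by simp
qed

lemma coeff_prod_linear:
  "Polynomial.coeff (\<Prod>c\<in>#C. [:- j c, 1:]) k = j (Polynomial.coeff (\<Prod>c\<in>#C. [:- c, 1:]) k)"
  by (induction C arbitrary: k) (auto simp: coeff_pCons one_pCons split: nat.split)

lemma coeff_bound: "\<exists>M. M \<noteq> 0 \<and> (\<forall>k. Polynomial.coeff p k \<preceq> M)"
proof (induction p)
  case 0
  show ?case using zero_le by (intro exI[of _ 1]) auto
next
  case (pCons a p)
  then obtain M where M: "M \<noteq> 0" "\<forall>k. Polynomial.coeff p k \<preceq> M" by blast
  show ?case
  proof (cases "a \<preceq> M")
    case True
    then show ?thesis using M by (intro exI[of _ M]) (auto simp: coeff_pCons split: nat.split)
  next
    case False
    then have "a \<noteq> 0" "M \<preceq> a" using zero_le total by auto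
    then show ?thesis using M trans by (intro exI[of _ a]) (auto simp: coeff_pCons split: nat.split)
  qed
qed

text \<open>
  The coefficients of a polynomial depend continuously on its roots. In the induction step the
  new root \<open>a\<close> is approximated last, when the bound \<open>M\<close> for the coefficients of the other factor
  is already fixed.
\<close>

lemma approximate_roots:
  assumes "e \<noteq> 0"
  shows "\<exists>C. size C = size A \<and>
    (\<forall>k. Polynomial.coeff ((\<Prod>a\<in>#A. [:- a, 1:]) - (\<Prod>c\<in>#C. [:- j c, 1:])) k \<prec> e)"
  using assms
proof (induction A arbitrary: e)
  case empty
  then show ?case by (intro exI[of _ "{#}"]) auto
next
  case (add a A)
  \<comment> \<open>Small enough for multiplication by the factor with root a to keep the coefficients below e.\<close>
  define e1 where "e1 = (if a \<preceq> 1 then e else e / a)"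
  have a0: "a \<noteq> 0" if "\<not> a \<preceq> 1" using that zero_le by auto
  have e1: "e1 \<noteq> 0" "e1 \<preceq> e" "a * e1 \<preceq> e"
  proof -
    show "e1 \<noteq> 0" using add.prems a0 by (auto simp: e1_def)
    show "a * e1 \<preceq> e"
      using a0 mult_mono[of a 1 e e] by (auto simp: e1_def)
    show "e1 \<preceq> e"
    proof (cases "a \<preceq> 1")
      case False
      then have "1 * (e / a) \<preceq> a * (e / a)" using total by (intro mult_mono) auto
      then show ?thesis using a0[OF False] False by (simp add: e1_def)
    qed (simp add: e1_def)
  qed
  let ?P = "\<Prod>a\<in>#A. [:- a, 1:]"
  obtain C where C: "size C = size A" "\<And>k. Polynomial.coeff (?P - (\<Prod>c\<in>#C. [:- j c, 1:])) k \<prec> e1"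
    using add.IH[OF e1(1)] by blast
  let ?Q = "\<Prod>c\<in>#C. [:- j c, 1:]"
  obtain M where M: "M \<noteq> 0" "\<And>k. Polynomial.coeff ?Q k \<preceq> M" using coeff_bound by blast
  obtain c where c: "a - j c \<prec> e / M" using dense[of "e / M" a] M(1) add.prems by auto
  have eq: "[:- a, 1:] * ?P - [:- j c, 1:] * ?Q
      = pCons 0 (?P - ?Q) - smult a (?P - ?Q) - smult (a - j c) ?Q"
    by (simp add: algebra_simps smult_diff_left smult_diff_right)
  have "Polynomial.coeff ([:- a, 1:] * ?P - [:- j c, 1:] * ?Q) k \<prec> e" for k
  proof -
    have 1: "Polynomial.coeff (pCons 0 (?P - ?Q)) k \<prec> e"
      using C(2) e1(2) lt_le_trans add.prems by (auto simp: coeff_pCons split: nat.split)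
    have 2: "Polynomial.coeff (smult a (?P - ?Q)) k \<prec> e"
    proof (cases "a = 0")
      case False
      have "Polynomial.coeff (?P - ?Q) k * a \<prec> e1 * a" using C(2) False by (intro mult_lt_le) auto
      then have "Polynomial.coeff (smult a (?P - ?Q)) k \<prec> a * e1" by (simp add: mult.commute)
      then show ?thesis using e1(3) by (rule lt_le_trans)
    qed (use add.prems in simp)
    have "(a - j c) * Polynomial.coeff ?Q k \<prec> e / M * M" using c M by (intro mult_lt_le) auto
    then have 3: "Polynomial.coeff (smult (a - j c) ?Q) k \<prec> e" using M(1) by simp
    show ?thesis unfolding eq coeff_diff[of "_ - _" "smult (a - j c) ?Q"] coeff_diff[of "pCons 0 _"]
      using 1 2 3 by (intro diff_lt)
  qed
  then show ?case using C(1) by (intro exI[of _ "add_mset c C"]) simp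
qed

definition splitting :: "'k poly \<Rightarrow> bool" where
  "splitting f \<longleftrightarrow> (\<exists>a C. f = smult a (\<Prod>c\<in>#C. [:- c, 1:]))"

lemma splitting_const: "splitting [:a:]"
  unfolding splitting_def by (intro exI[of _ a] exI[of _ "{#}"]) simp

lemma splitting_monomial: "splitting ([:a:] * [:0, 1:] ^ n)"
  unfolding splitting_def by (intro exI[of _ a] exI[of _ "replicate_mset n 0"]) simp

text \<open>
  Split \<open>f\<close> over the algebraically closed field and move its roots to \<open>K\<close>, keeping the leading
  coefficient.
\<close>

lemma approximate_splitting:
  assumes "e \<noteq> 0"
  obtains g where "splitting g" "Polynomial.degree g \<le> Polynomial.degree f"
    "\<And>k. j (Polynomial.coeff (f - g) k) \<prec> j e"
proof (cases "f = 0")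
  case True
  then show thesis using that[of 0] splitting_const[of 0] assms by simp
next
  case False
  let ?a = "Polynomial.lead_coeff f"
  have a: "?a \<noteq> 0" using False by simp
  define F where "F = map_poly j f"
  have co: "Polynomial.coeff F k = j (Polynomial.coeff f k)" for k by (simp add: F_def coeff_map_poly)
  have deg: "Polynomial.degree F = Polynomial.degree f" by (simp add: F_def degree_map_poly)
  have "F \<noteq> 0" using co[of "Polynomial.degree f"] a by force
  then obtain A where A: "size A = Polynomial.degree f" "F = smult (j ?a) (\<Prod>x\<in>#A. [:- x, 1:])"
    using alg_closed_imp_factorization[of F] by (auto simp: deg co)
  obtain C where C: "size C = size A"
      "\<And>k. Polynomial.coeff ((\<Prod>a\<in>#A. [:- a, 1:]) - (\<Prod>c\<in>#C. [:- j c, 1:])) k \<prec> j (e / ?a)"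
    using approximate_roots[of "j (e / ?a)" A] a assms by auto
  define g where "g = smult ?a (\<Prod>c\<in>#C. [:- c, 1:])"
  have "j (Polynomial.coeff (f - g) k) \<prec> j e" for k
  proof -
    have "Polynomial.coeff ((\<Prod>a\<in>#A. [:- a, 1:]) - (\<Prod>c\<in>#C. [:- j c, 1:])) k * j ?a \<prec> j (e / ?a) * j ?a"
      using C(2) a by (intro mult_lt_le) auto
    moreover have "j (e / ?a) * j ?a = j e" using a by simp
    moreover have "Polynomial.coeff ((\<Prod>a\<in>#A. [:- a, 1:]) - (\<Prod>c\<in>#C. [:- j c, 1:])) k * j ?a
        = Polynomial.coeff F k - j (Polynomial.coeff g k)"
      by (simp add: A(2) g_def coeff_prod_linear algebra_simps)
    ultimately show ?thesis by (simp add: co)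
  qed
  moreover have "splitting g" unfolding splitting_def g_def by blast
  moreover have "Polynomial.degree (\<Prod>c\<in>#C. [:- c, 1:]) \<le> size C" for C :: "'k multiset"
  proof (induction C)
    case (add c C)
    have "Polynomial.degree ([:- c, 1:] * (\<Prod>c\<in>#C. [:- c, 1:])) \<le> 1 + Polynomial.degree (\<Prod>c\<in>#C. [:- c, 1:])"
      using degree_mult_le[of "[:- c, 1:]" "\<Prod>c\<in>#C. [:- c, 1:]"] by simp
    then show ?case using add by (simp only: image_mset_add_mset prod_mset.add_mset size_add_mset)
  qed simp
  then have "Polynomial.degree g \<le> Polynomial.degree f"
    using A(1) C(1) a by (simp add: g_def) metis
  ultimately show thesis using that by blast
qed

end

text \<open>
  Two extensions to \<open>K[x]\<close> of the relation on \<open>K\<close>, with the same comparisons of the elements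
  \<open>x - c\<close> with constants. To have the same approximation type means just this.
\<close>

locale extension_pair = dense_valued below j + A: poly_valuative le1 + B: poly_valuative le2
  for below :: "'l::alg_closed_field \<Rightarrow> 'l \<Rightarrow> bool" (infix "\<preceq>" 50)
    and j :: "'k::field \<Rightarrow> 'l" and le1 le2 :: "'k poly \<Rightarrow> 'k poly \<Rightarrow> bool" +
  assumes const1 [simp]: "le1 [:a:] [:b:] \<longleftrightarrow> j a \<preceq> j b"
    and const2 [simp]: "le2 [:a:] [:b:] \<longleftrightarrow> j a \<preceq> j b"
    and linear_le: "le1 [:- c, 1:] [:a:] \<longleftrightarrow> le2 [:- c, 1:] [:a:]"
    and linear_ge: "le1 [:a:] [:- c, 1:] \<longleftrightarrow> le2 [:a:] [:- c, 1:]"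
begin

text \<open>
  Replacing a polynomial by another one that has the same absolute value in both extensions is the
  way in which a comparison is reduced to easier ones.
\<close>

definition agree :: "'k poly \<Rightarrow> 'k poly \<Rightarrow> bool" where
  "agree f g \<longleftrightarrow> A.same f g \<and> B.same f g"

definition comparable :: "'k poly \<Rightarrow> 'k poly \<Rightarrow> bool" where
  "comparable f g \<longleftrightarrow> (le1 f g \<longleftrightarrow> le2 f g) \<and> (le1 g f \<longleftrightarrow> le2 g f)"

lemma agree_mult: "agree f g \<Longrightarrow> agree f' g' \<Longrightarrow> agree (f * f') (g * g')"
  unfolding agree_def using A.mult_same B.mult_same by blast

lemma agree_refl [simp]: "agree f f"
  by (simp add: agree_def)

lemma comparable_sym: "comparable f g \<Longrightarrow> comparable g f"
  by (auto simp: comparable_def)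

lemma agree_comparable:
  assumes "agree f f'" "agree g g'"
  shows "comparable f g \<longleftrightarrow> comparable f' g'"
  using assms A.same_le[of f f' g g'] A.same_le[of g g' f f'] B.same_le[of f f' g g'] B.same_le[of g g' f f']
  by (simp add: agree_def comparable_def)

lemma comparable_cancel: "h \<noteq> 0 \<Longrightarrow> comparable (f * h) (g * h) \<longleftrightarrow> comparable f g"
  by (simp add: comparable_def A.mult_right B.mult_right)

lemma comparable_0: "comparable 0 g"
  using A.zero_le B.zero_le A.le_zero B.le_zero by (auto simp: comparable_def)

lemma comparable_const: "comparable [:a:] [:b:]"
  by (simp add: comparable_def)

lemma comparable_linear: "comparable [:- c, 1:] [:a:]"
  using linear_le linear_ge by (simp add: comparable_def)

lemma agree_const: "agree [:a:] [:b:] \<longleftrightarrow> j a \<asymp> j b"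
  by (auto simp: agree_def A.same_def B.same_def same_def)

text \<open>
  By divisibility the constant has the absolute value of an \<open>n\<close>-th power, and \<open>n\<close>-th roots may
  be taken on both sides of a comparison.
\<close>

lemma comparable_power:
  assumes "\<And>e. comparable y [:e:]"
  shows "comparable (y ^ n) [:a:]"
proof (cases "n = 0")
  case True
  then show ?thesis using comparable_const[of 1] by (simp add: one_pCons)
next
  case False
  then obtain e where "j e ^ n \<asymp> j a" using root_value[of n a] by blast
  then have "agree [:a:] ([:e:] ^ n)" by (simp add: poly_const_pow agree_const same_sym)
  moreover have "comparable (y ^ n) ([:e:] ^ n)"
    using False assms[of e] by (simp add: comparable_def A.power_le_iff B.power_le_iff)
  ultimately show ?thesis using agree_comparable[OF agree_refl] by blast
qed

lemma comparable_monomials: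
  assumes y: "\<And>e. comparable y [:e:]" "y \<noteq> 0" and mn: "m \<le> n"
  shows "comparable ([:a:] * y ^ m) ([:b:] * y ^ n)"
proof (cases "b = 0")
  case True
  then show ?thesis using comparable_sym[OF comparable_0] by simp
next
  case False
  have "comparable (y ^ (n - m)) [:a / b:]" using y(1) by (rule comparable_power)
  then have "comparable (y ^ (n - m) * [:b:]) ([:a / b:] * [:b:])"
    using False comparable_cancel[of "[:b:]"] by (metis pCons_eq_0_iff)
  moreover have "[:a / b:] * [:b:] = [:a:]" using False by simp
  ultimately have "comparable (y ^ (n - m) * [:b:] * y ^ m) ([:a:] * y ^ m)"
    using comparable_cancel y(2) by (metis power_not_zero)
  moreover have "y ^ (n - m) * [:b:] * y ^ m = [:b:] * y ^ n"
    using mn by (simp add: ac_simps flip: power_add)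
  ultimately show ?thesis by (simp add: comparable_sym)
qed

text \<open>
  Either each \<open>\<bar>x - c\<bar>\<close> is the absolute value of a constant, and \<open>y = 1\<close> will do, or some \<open>\<bar>x - d\<bar>\<close>
  is not, and \<open>y = x - d\<close> will do: then \<open>\<bar>x - d\<bar> \<noteq> \<bar>d - c\<bar>\<close> for each \<open>c\<close>, hence \<open>\<bar>x - c\<bar>\<close> is the
  larger of the two. In both cases split polynomials become monomials in \<open>y\<close>.
\<close>

lemma splitting_monomial_form:
  obtains y where "y \<noteq> 0" "\<And>e. comparable y [:e:]" "\<And>f. splitting f \<Longrightarrow> \<exists>b m. agree f ([:b:] * y ^ m)"
proof -
  have "\<exists>y. y \<noteq> 0 \<and> (\<forall>e. comparable y [:e:]) \<and> (\<forall>c. agree [:- c, 1:] y \<or> (\<exists>b. agree [:- c, 1:] [:b:]))"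
  proof (cases "\<forall>c. \<exists>b. A.same [:- c, 1:] [:b:]")
    case True
    have "\<exists>b. agree [:- c, 1:] [:b:]" for c
    proof -
      obtain b where "A.same [:- c, 1:] [:b:]" using True by blast
      then have "agree [:- c, 1:] [:b:]"
        using linear_le[of c b] linear_ge[of b c] by (simp add: agree_def A.same_def B.same_def)
      then show ?thesis by blast
    qed
    then show ?thesis using comparable_const[of 1] by (intro exI[of _ 1]) (auto simp: one_pCons)
  next
    case False
    then obtain d where d: "\<And>b. \<not> A.same [:- d, 1:] [:b:]" by blast
    let ?y = "[:- d, 1:]"
    have "agree [:- c, 1:] ?y \<or> (\<exists>b. agree [:- c, 1:] [:b:])" for c
    proof -
      have sum: "[:- c, 1:] = ?y + [:d - c:]" "[:- c, 1:] = [:d - c:] + ?y" by simp_all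
      consider "A.lt [:d - c:] ?y" | "A.lt ?y [:d - c:]"
        using d[of "d - c"] by (auto simp: A.same_def A.lt_def)
      then show ?thesis
      proof cases
        case 1
        then have "B.lt [:d - c:] ?y" using linear_le by (simp add: A.lt_def B.lt_def)
        then have "agree [:- c, 1:] ?y"
          unfolding agree_def sum(1) using 1 A.add_dominant B.add_dominant by blast
        then show ?thesis by blast
      next
        case 2
        then have "B.lt ?y [:d - c:]" using linear_ge by (simp add: A.lt_def B.lt_def)
        then have "agree [:- c, 1:] [:d - c:]"
          unfolding agree_def sum(2) using 2 A.add_dominant B.add_dominant by blast
        then show ?thesis by blast
      qed
    qed
    then show ?thesis using comparable_linear by (intro exI[of _ ?y]) auto
  qed
  then obtain y where y: "y \<noteq> 0" "\<And>e. comparable y [:e:]"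
    "\<And>c. agree [:- c, 1:] y \<or> (\<exists>b. agree [:- c, 1:] [:b:])" by blast
  have prod: "\<exists>b m. agree (\<Prod>c\<in>#C. [:- c, 1:]) ([:b:] * y ^ m)" for C
  proof (induction C)
    case empty
    show ?case by (rule exI[of _ 1], rule exI[of _ 0]) (simp add: one_pCons)
  next
    case (add c C)
    then obtain b m where bm: "agree (\<Prod>c\<in>#C. [:- c, 1:]) ([:b:] * y ^ m)" by blast
    consider "agree [:- c, 1:] y" | d where "agree [:- c, 1:] [:d:]" using y(3) by blast
    then show ?case
    proof cases
      case 1
      from agree_mult[OF 1 bm] have "agree ([:- c, 1:] * (\<Prod>c\<in>#C. [:- c, 1:])) ([:b:] * y ^ Suc m)"
        by (simp only: power_Suc ac_simps)
      then show ?thesis by (auto simp only: image_mset_add_mset prod_mset.add_mset)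
    next
      case 2
      from agree_mult[OF 2 bm] have "agree ([:- c, 1:] * (\<Prod>c\<in>#C. [:- c, 1:])) ([:d:] * [:b:] * y ^ m)"
        by (simp only: ac_simps)
      moreover have "[:d:] * [:b:] = [:d * b:]" by simp
      ultimately have "agree ([:- c, 1:] * (\<Prod>c\<in>#C. [:- c, 1:])) ([:d * b:] * y ^ m)" by metis
      then show ?thesis by (auto simp only: image_mset_add_mset prod_mset.add_mset)
    qed
  qed
  have "\<exists>b m. agree f ([:b:] * y ^ m)" if sf: "splitting f" for f
  proof -
    obtain a C where "f = smult a (\<Prod>c\<in>#C. [:- c, 1:])" using sf unfolding splitting_def by blast
    then have f: "f = [:a:] * (\<Prod>c\<in>#C. [:- c, 1:])" by simp
    obtain b m where bm: "agree (\<Prod>c\<in>#C. [:- c, 1:]) ([:b:] * y ^ m)" using prod by blast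
    have "agree f ([:a:] * ([:b:] * y ^ m))" unfolding f using bm by (intro agree_mult) auto
    moreover have "[:a:] * ([:b:] * y ^ m) = [:a * b:] * y ^ m" by (simp add: mult.commute)
    ultimately show ?thesis by metis
  qed
  then show thesis using that y by blast
qed

lemma comparable_splitting:
  assumes "splitting f" "splitting g"
  shows "comparable f g"
proof -
  obtain y where y: "y \<noteq> 0" "\<And>e. comparable y [:e:]" "\<And>f. splitting f \<Longrightarrow> \<exists>b m. agree f ([:b:] * y ^ m)"
    using splitting_monomial_form by blast
  obtain a m b n where fg: "agree f ([:a:] * y ^ m)" "agree g ([:b:] * y ^ n)" using y(3) assms by meson
  have "comparable ([:a:] * y ^ m) ([:b:] * y ^ n)"
    using comparable_monomials[OF y(2,1), of m n a b] comparable_monomials[OF y(2,1), of n m b a]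
    by (cases "m \<le> n") (auto intro: comparable_sym)
  then show ?thesis using agree_comparable[OF fg] by simp
qed

lemma comparable_unbounded:
  assumes x: "\<And>b. \<not> le1 [:0, 1:] [:b:]"
  shows "comparable f g"
proof -
  have split: "\<exists>f'. splitting f' \<and> agree f f'" for f
  proof (cases "f = 0")
    case True
    then show ?thesis using splitting_const[of 0] by auto
  next
    case False
    have "A.lt [:b:] [:0, 1:]" "B.lt [:b:] [:0, 1:]" for b
      using x[of b] linear_le[of 0 b] by (simp_all add: A.lt_def B.lt_def)
    then have "agree f ([:Polynomial.lead_coeff f:] * [:0, 1:] ^ Polynomial.degree f)"
      unfolding agree_def using A.leading_term B.leading_term False by blast
    then show ?thesis using splitting_monomial by blast
  qed
  obtain f' where f': "splitting f'" "agree f f'" using split by blast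
  obtain g' where g': "splitting g'" "agree g g'" using split by blast
  show ?thesis using agree_comparable[OF f'(2) g'(2)] comparable_splitting[OF f'(1) g'(1)] by simp
qed

text \<open>
  The polynomials that are infinitely small compared with \<open>K\<close>. Knowing such a polynomial up to an
  error bounded by a constant, however small, does not reveal its absolute value.
\<close>

definition small :: "'k poly \<Rightarrow> bool" where
  "small f \<longleftrightarrow> (\<forall>e. e \<noteq> 0 \<longrightarrow> A.lt f [:e:])"

context
  fixes b :: 'k
  assumes x_le: "le1 [:0, 1:] [:b:]"
begin

text \<open>
  How small the coefficients of \<open>f - g\<close> must be depends on the extension only through a bound for
  \<open>\<bar>x\<bar>\<close>, and \<open>\<bar>x\<bar> \<le> \<bar>b\<bar>\<close> holds in both extensions; so one approximation serves both of them.
\<close>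

lemma approximate_both:
  assumes "e \<noteq> 0"
  obtains g where "splitting g" "A.lt (f - g) [:e:]" "B.lt (f - g) [:e:]"
proof -
  have "\<exists>d. j b \<preceq> j d \<and> j 1 \<preceq> j d" using total[of "j b" "j 1"] refl by blast
  then obtain d where d: "j b \<preceq> j d" "1 \<preceq> j d" by auto
  have x: "le1 [:0, 1:] [:d:]" "le2 [:0, 1:] [:d:]"
    using x_le d(1) linear_le[of 0 b] A.trans[of "[:0, 1:]" "[:b:]" "[:d:]"] B.trans[of "[:0, 1:]" "[:b:]" "[:d:]"]
    by auto
  have one: "le1 1 [:d:]" "le2 1 [:d:]" using d(2) by (auto simp: one_pCons)
  have d0: "d \<noteq> 0" using d(2) by auto
  let ?n = "Polynomial.degree f" and ?e = "e / d ^ Polynomial.degree f"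
  have e: "?e \<noteq> 0" "?e * d ^ ?n = e" using assms d0 by auto
  obtain g where g: "splitting g" "Polynomial.degree g \<le> ?n" "\<And>k. j (Polynomial.coeff (f - g) k) \<prec> j ?e"
    using approximate_splitting[OF e(1), of f] by blast
  have deg: "Polynomial.degree (f - g) \<le> ?n" using g(2) by (intro degree_diff_le) auto
  have "A.lt (f - g) [:?e * d ^ ?n:]"
    using g(3) by (intro A.poly_lt x one deg e(1)) (auto simp: A.lt_def lt_def)
  moreover have "B.lt (f - g) [:?e * d ^ ?n:]"
    using g(3) by (intro B.poly_lt x one deg e(1)) (auto simp: B.lt_def lt_def)
  ultimately show thesis using that g(1) e(2) by metis
qed

text \<open>
  An error smaller than \<open>\<bar>e\<bar>\<close> does not affect the comparison with \<open>e\<close>, so \<open>f\<close> may be replaced by a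
  split polynomial. In particular both extensions have the same small polynomials.
\<close>

lemma lt_const_iff:
  assumes "e \<noteq> 0"
  shows "A.lt f [:e:] \<longleftrightarrow> B.lt f [:e:]"
proof -
  obtain g where g: "splitting g" "A.lt (f - g) [:e:]" "B.lt (f - g) [:e:]"
    using approximate_both[OF assms] by blast
  have "A.lt f [:e:] \<longleftrightarrow> A.lt g [:e:]"
    using A.diff_lt[OF _ g(2), of f] A.add_lt[OF _ g(2), of g] by auto
  moreover have "B.lt f [:e:] \<longleftrightarrow> B.lt g [:e:]"
    using B.diff_lt[OF _ g(3), of f] B.add_lt[OF _ g(3), of g] by auto
  moreover have "A.lt g [:e:] \<longleftrightarrow> B.lt g [:e:]"
    using comparable_splitting[OF g(1) splitting_const] by (simp add: comparable_def A.lt_def B.lt_def)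
  ultimately show ?thesis by simp
qed

text \<open>
  If \<open>\<bar>f\<bar>\<close> is at least \<open>\<bar>e\<bar>\<close>, an approximation \<open>g\<close> with \<open>\<bar>f - g\<bar> < \<bar>e\<bar>\<close> has the absolute value of \<open>f\<close>.
\<close>

lemma agree_splitting:
  assumes "\<not> small f"
  obtains g where "splitting g" "agree f g"
proof -
  obtain e where e: "e \<noteq> 0" "\<not> A.lt f [:e:]" using assms by (auto simp: small_def)
  obtain g where g: "splitting g" "A.lt (f - g) [:e:]" "B.lt (f - g) [:e:]"
    using approximate_both[OF e(1)] by blast
  have "A.lt (f - g) f" "B.lt (f - g) f"
    using g(2,3) e lt_const_iff[OF e(1)] A.not_lt B.not_lt A.lt_le_trans B.lt_le_trans by blast+
  then have "agree f g" unfolding agree_def using A.close_same B.close_same A.same_sym B.same_sym by blast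
  then show thesis using that g(1) by blast
qed

lemma small_diff: "small f \<Longrightarrow> small g \<Longrightarrow> small (f - g)"
  by (simp add: small_def A.diff_lt)

lemma small_mult:
  assumes "small f"
  shows "small (f * q)"
  unfolding small_def
proof (intro allI impI)
  fix e :: 'k assume e: "e \<noteq> 0"
  obtain d where d: "d \<noteq> 0" "le1 q [:d:]" using A.poly_le[OF x_le] by blast
  have "A.lt (f * q) ([:e / d:] * [:d:])"
    using assms d e by (intro A.mult_lt_le) (auto simp: small_def)
  then show "A.lt (f * q) [:e:]" using d(1) by simp
qed

text \<open>
  The small polynomials form an ideal because \<open>K[x]\<close> is bounded by constants. A generator is not
  a nonzero constant, for such a constant is not smaller than itself.
\<close>

lemma small_principal:
  obtains p where "p = 0 \<or> Polynomial.degree p > 0" "\<And>f. small f \<longleftrightarrow> p dvd f"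
proof (cases "\<exists>f. small f \<and> f \<noteq> 0")
  case False
  have "small 0" by (simp add: small_def)
  then show thesis using that[of 0] False by auto
next
  case True
  define p where "p = arg_min Polynomial.degree (\<lambda>f. small f \<and> f \<noteq> 0)"
  have p: "small p" "p \<noteq> 0" "\<And>f. small f \<Longrightarrow> f \<noteq> 0 \<Longrightarrow> Polynomial.degree p \<le> Polynomial.degree f"
    using True arg_min_natI[of "\<lambda>f. small f \<and> f \<noteq> 0" _ Polynomial.degree]
      arg_min_nat_le[of "\<lambda>f. small f \<and> f \<noteq> 0" _ Polynomial.degree] unfolding p_def by blast+
  have "Polynomial.degree p > 0"
  proof (rule ccontr)
    assume "\<not> Polynomial.degree p > 0"
    then obtain a where a: "p = [:a:]" using degree_eq_zeroE by auto
    then have "A.lt [:a:] [:a:]" using p(1,2) by (auto simp: small_def)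
    then show False by (simp add: A.lt_def)
  qed
  moreover have "small f \<longleftrightarrow> p dvd f" for f
  proof
    assume f: "small f"
    have "f mod p = f - p * (f div p)" by (simp add: minus_mult_div_eq_mod)
    then have "small (f mod p)" using f small_mult[OF p(1)] small_diff by metis
    then show "p dvd f"
      using p(2,3) degree_mod_less_degree[of p f] by (metis dvd_eq_mod_eq_0 not_le)
  qed (use small_mult p(1) in auto)
  ultimately show thesis using that by blast
qed

text \<open>
  A small polynomial is smaller than one that is not small, and two small ones are compared after
  division by the common generator.
\<close>

lemma comparable_bounded: "comparable f g"
proof -
  obtain p where p: "p = 0 \<or> Polynomial.degree p > 0" "\<And>f. small f \<longleftrightarrow> p dvd f"
    using small_principal by blast
  have mixed: "comparable f g" if fg: "small f" "\<not> small g" for f g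
  proof -
    obtain e where e: "e \<noteq> 0" "\<not> A.lt g [:e:]" using fg(2) by (auto simp: small_def)
    have "A.lt f [:e:]" using fg(1) e(1) by (simp add: small_def)
    then have "A.lt f g" "B.lt f g"
      using e lt_const_iff[OF e(1)] A.not_lt B.not_lt A.lt_le_trans B.lt_le_trans by blast+
    then show ?thesis using A.lt_imp_le B.lt_imp_le by (auto simp: comparable_def A.lt_def B.lt_def)
  qed
  show ?thesis
  proof (induction "Polynomial.degree f" arbitrary: f g rule: less_induct)
    case (less f g)
    consider "f = 0" | "g = 0" | "\<not> small f" "\<not> small g" | "small f \<noteq> small g" | "f \<noteq> 0" "g \<noteq> 0" "small f" "small g"
      by blast
    then show ?case
    proof cases
      case 3
      obtain f' where f': "splitting f'" "agree f f'" using agree_splitting[OF 3(1)] by blast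
      obtain g' where g': "splitting g'" "agree g g'" using agree_splitting[OF 3(2)] by blast
      show ?thesis using agree_comparable[OF f'(2) g'(2)] comparable_splitting[OF f'(1) g'(1)] by simp
    next
      case 4
      then show ?thesis using mixed comparable_sym by blast
    next
      case 5
      then obtain f' g' where f': "f = p * f'" "g = p * g'" using p(2) by (auto elim!: dvdE)
      then have "p \<noteq> 0" "f' \<noteq> 0" using 5 by auto
      then have "Polynomial.degree f' < Polynomial.degree f"
        using p(1) by (simp add: f'(1) degree_mult_eq)
      then have "comparable f' g'" by (rule less)
      then show ?thesis using comparable_cancel[OF \<open>p \<noteq> 0\<close>, of f' g'] by (simp add: f' mult.commute)
    qed (use comparable_0 comparable_sym in auto)
  qed
qed

end

theorem relations_eq: "le1 f g \<longleftrightarrow> le2 f g"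
proof -
  have "comparable f g"
    using comparable_unbounded comparable_bounded by blast
  then show ?thesis by (simp add: comparable_def)
qed

end

section \<open>Existence of an extension with a given approximation type\<close>
text \<open>
  Zorn's lemma for the proper filters below \<open>F\<close>. A minimal one cannot be refined by any predicate
  \<open>P\<close>, so it contains \<open>P\<close> or its complement.
\<close>

lemma ex_ultrafilter_le:
  fixes F :: "'a filter"
  assumes "F \<noteq> bot"
  obtains U where "U \<le> F" "U \<noteq> bot" "\<And>P. eventually P U \<or> eventually (\<lambda>x. \<not> P x) U"
proof -
  let ?A = "{U. U \<noteq> bot \<and> U \<le> F}" and ?P = "\<lambda>U V :: 'a filter. V \<le> U"
  have "\<exists>U\<in>?A. \<forall>V\<in>?A. V \<le> U \<longrightarrow> V = U"
  proof (rule predicate_Zorn)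
    show "partial_order_on ?A (relation_of ?P ?A)"
      by (auto simp: partial_order_on_def preorder_on_def refl_on_def trans_def antisym_def relation_of_def)
    fix C assume C: "C \<in> Chains (relation_of ?P ?A)"
    then have sub: "C \<subseteq> ?A" and chain: "U \<le> V \<or> V \<le> U" if "U \<in> C" "V \<in> C" for U V
      using that by (auto simp: Chains_def relation_of_def)
    show "\<exists>U\<in>?A. \<forall>V\<in>C. U \<le> V"
    proof (cases "C = {}")
      case True
      then show ?thesis using assms by auto
    next
      case False
      then have sub: "C \<subseteq> ?A" using sub by blast
      have "(INF U\<in>C. U) \<noteq> bot"
      proof (rule INF_filter_not_bot)
        fix Y assume Y: "Y \<subseteq> C" "finite Y"
        have "Y \<noteq> {} \<longrightarrow> (\<exists>U\<in>Y. \<forall>V\<in>Y. U \<le> V)"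
          using Y(2,1)
        proof induction
          case (insert V Y)
          show ?case
          proof (cases "Y = {}")
            case False
            then obtain U where U: "U \<in> Y" "\<forall>V\<in>Y. U \<le> V" using insert by auto
            then have "U \<le> V \<or> V \<le> U" using insert.prems by (intro chain) auto
            then show ?thesis using U by (auto intro: order_trans)
          qed simp
        qed simp
        then show "(INF U\<in>Y. U) \<noteq> bot"
        proof (cases "Y = {}")
          case True
          have "(top_class.top :: 'a filter) \<noteq> bot" using assms by (metis bot.extremum_unique top_greatest)
          then show ?thesis using True by simp
        next
          case False
          then obtain U where U: "U \<in> Y" "\<forall>V\<in>Y. U \<le> V" using \<open>Y \<noteq> {} \<longrightarrow> _\<close> by blast
          then have "U \<le> (INF U\<in>Y. U)" by (simp add: complete_lattice_class.Inf_greatest)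
          moreover have "U \<noteq> bot" using U Y sub by blast
          ultimately show ?thesis by (metis bot.extremum_unique)
        qed
      qed
      moreover have "(INF U\<in>C. U) \<le> V" if "V \<in> C" for V
        using that by (intro INF_lower)
      ultimately show ?thesis using False sub by (intro bexI[of _ "INF U\<in>C. U"]) (auto intro: order_trans)
    qed
  qed
  then obtain U where U: "U \<noteq> bot" "U \<le> F" "\<And>V. V \<noteq> bot \<Longrightarrow> V \<le> U \<Longrightarrow> V = U"
    by (metis (mono_tags, lifting) mem_Collect_eq order_trans)
  have "eventually P U \<or> eventually (\<lambda>x. \<not> P x) U" for P
  proof (cases "inf U (principal {x. P x}) = bot")
    case True
    then have "eventually (\<lambda>x. False) (inf U (principal {x. P x}))" by simp
    then show ?thesis by (simp add: eventually_inf_principal)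
  next
    case False
    then have "inf U (principal {x. P x}) = U" by (intro U) auto
    moreover have "eventually P (inf U (principal {x. P x}))" by (simp add: eventually_inf_principal)
    ultimately show ?thesis by simp
  qed
  then show thesis using that U by blast
qed

lemma fip_ultrafilter:
  fixes family :: "'a set set"
  assumes "\<And>Y. finite Y \<Longrightarrow> Y \<subseteq> family \<Longrightarrow> \<Inter>Y \<noteq> {}"
  obtains U :: "'a filter" where "U \<noteq> bot" "\<And>P. eventually P U \<or> eventually (\<lambda>x. \<not> P x) U"
    "\<And>S. S \<in> family \<Longrightarrow> eventually (\<lambda>x. x \<in> S) U"
proof -
  have "(INF S\<in>family. principal S) \<noteq> bot"
  proof (rule INF_filter_not_bot)
    fix Y assume Y: "Y \<subseteq> family" "finite Y"
    have "(INF S\<in>Y. principal S) = principal (\<Inter>Y)"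
      using Y(2) INF_principal_finite[of Y "\<lambda>S. S"] by simp
    then show "(INF S\<in>Y. principal S) \<noteq> bot" using assms Y by (simp add: principal_eq_bot_iff)
  qed
  then obtain U where U: "U \<le> (INF S\<in>family. principal S)" "U \<noteq> bot"
    "\<And>P. eventually P U \<or> eventually (\<lambda>x. \<not> P x) U"
    using ex_ultrafilter_le by blast
  have "eventually (\<lambda>x. x \<in> S) U" if "S \<in> family" for S
  proof -
    have "U \<le> principal S" using U(1) that by (meson INF_lower order_trans)
    then show ?thesis by (simp add: le_principal)
  qed
  then show thesis using that U by blast
qed

context dense_valued
begin

text \<open>
  This says that the residue field is infinite. After scaling, the centres in the ball become
  integral elements \<open>u\<close>. A root \<open>z\<close> of the polynomial \<open>\<Prod>(T - u) - 1\<close> is integral, so the integral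
  elements \<open>z - u\<close>, whose product is \<open>1\<close>, are units. An element of \<open>K\<close> close to \<open>z\<close> has the same
  property.
\<close>

lemma closed_ball_not_covered:
  assumes a: "a \<noteq> 0" and D: "finite D"
  obtains d where "j (d - c) \<preceq> j a" "\<And>e. e \<in> D \<Longrightarrow> j a \<preceq> j (d - e)"
proof -
  \<comment> \<open>The centre c is included so that the polynomial below is not constant. Centres outside the ball are harmless.\<close>
  define E where "E = insert c {e \<in> D. j (e - c) \<preceq> j a}"
  have E: "finite E" "E \<noteq> {}" using D by (auto simp: E_def)
  let ?u = "\<lambda>e. j ((e - c) / a)"
  have u: "?u e \<preceq> 1" if "e \<in> E" for e
  proof -
    have "j (e - c) \<preceq> j a" using that by (auto simp: E_def zero_le)
    moreover have "?u e * j a = j (e - c)" using a by (simp flip: j_mult)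
    ultimately show ?thesis using mult_right[of "j a" "?u e" 1] a by simp
  qed
  let ?p = "(\<Prod>e\<in>E. [:- ?u e, 1:])"
  have "Polynomial.degree ?p = card E"
    by (subst degree_prod_eq_sum_degree) (auto simp: E)
  then have "Polynomial.degree (?p - 1) > 0"
    using E degree_add_eq_left[of "- 1" ?p] by (simp add: card_gt_0_iff)
  then obtain z where "poly (?p - 1) z = 0" using alg_closed_imp_poly_has_root by blast
  then have z: "(\<Prod>e\<in>E. z - ?u e) = 1" by (simp add: poly_prod)
  have z1: "z \<preceq> 1"
  proof (rule ccontr)
    assume nz: "\<not> z \<preceq> 1"
    have gt: "1 \<prec> z - ?u e" if "e \<in> E" for e
    proof -
      have "?u e \<prec> z" using u[OF that] nz by (meson le_lt_trans lt_def)
      then have "z + - ?u e \<asymp> z" by (intro add_dominant) simp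
      then show ?thesis using nz by (auto simp: same_def lt_def intro: trans)
    qed
    have "1 \<prec> (\<Prod>e\<in>E. z - ?u e)"
      using E gt
    proof (induction E rule: finite_ne_induct)
      case (insert e E)
      have p: "1 \<prec> (\<Prod>e\<in>E. z - ?u e)" by (rule insert.IH) (use insert.prems in blast)
      then have "0 \<prec> (\<Prod>e\<in>E. z - ?u e)" using le_lt_trans zero_le by blast
      then have "1 * 1 \<prec> (z - ?u e) * (\<Prod>e\<in>E. z - ?u e)"
        using insert.prems lt_imp_le[OF p] lt_zero by (intro mult_lt_le) blast+
      then show ?case using insert by simp
    qed auto
    then show False unfolding z by (simp add: lt_def)
  qed
  have zu: "z - ?u e \<preceq> 1" if "e \<in> E" for e
    using z1 u[OF that] by (rule diff_le)
  have one: "1 \<preceq> z - ?u e" if e: "e \<in> E" for e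
  proof -
    have "(\<Prod>e\<in>E'. z - ?u e) \<preceq> 1" if "E' \<subseteq> E" for E'
    proof -
      have "finite E'" using E(1) that finite_subset by blast
      then show ?thesis using that
      proof induction
        case (insert x E')
        have "(z - ?u x) * (\<Prod>e\<in>E'. z - ?u e) \<preceq> 1 * 1" using insert zu by (intro mult_mono) auto
        then show ?case using insert by simp
      qed simp
    qed
    then have "(z - ?u e) * (\<Prod>e\<in>E - {e}. z - ?u e) \<preceq> (z - ?u e) * 1" by (intro mult_mono) auto
    then show ?thesis using z E(1) e by (simp add: prod.remove)
  qed
  obtain w where w: "z - j w \<prec> 1" using dense[of 1 z] by auto
  define d where "d = c + a * w"
  have dj: "j (d - e) = j a * (j w - ?u e)" for e
  proof -
    have "d - e = a * (w - (e - c) / a)" using a by (simp add: d_def field_simps)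
    then show ?thesis by (simp only: j_mult j_diff)
  qed
  have "j w - z \<preceq> 1" using w lt_imp_le by (simp add: diff_commute_le)
  then have "j w - z + z \<preceq> 1" using z1 by (rule add_le)
  then have w1: "j w \<preceq> 1" by simp
  have dc: "j (d - c) \<preceq> j a" using dj[of c] mult_mono[OF refl w1, of "j a"] by simp
  moreover have "j a \<preceq> j (d - e)" if e: "e \<in> D" for e
  proof (cases "e \<in> E")
    case True
    have "z - j w \<prec> z - ?u e" using w one[OF True] by (rule lt_le_trans)
    then have "(z - ?u e) + - (z - j w) \<asymp> z - ?u e" by (intro add_dominant) (simp only: minus_lt)
    then have "1 \<preceq> j w - ?u e" using one[OF True] by (auto simp: same_def intro: trans)
    then show ?thesis using mult_mono[OF refl, of 1 "j w - ?u e" "j a"] dj[of e] by simp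
  next
    case False
    then have "j a \<prec> j (e - c)" using e by (auto simp: E_def lt_def)
    then have "j (d - c) \<prec> j (e - c)" using dc by (rule le_lt_trans[rotated])
    then have "j (e - c) + - j (d - c) \<asymp> j (e - c)" by (intro add_dominant) (simp only: minus_lt)
    then have "j (e - d) \<asymp> j (e - c)" by simp
    then have "j a \<preceq> j (e - d)"
      using trans[OF lt_imp_le[OF \<open>j a \<prec> j (e - c)\<close>]] by (simp add: same_def)
    then show ?thesis using minus_le(2)[of "j a" "j (d - e)"] by simp
  qed
  ultimately show thesis using that by blast
qed

text \<open>
  The geometric mean of the two values exists by divisibility.
\<close>

lemma value_between:
  assumes "j b \<prec> j a" "b \<noteq> 0"
  obtains e where "j b \<prec> j e" "j e \<prec> j a"
proof -
  obtain e where e: "j e ^ 2 \<asymp> j (a * b)" using root_value[of 2 "a * b"] by auto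
  have a: "a \<noteq> 0" using assms(1) by (auto simp: lt_def zero_le)
  have "j b * j b \<prec> j a * j b" "j b * j a \<prec> j a * j a"
    using assms a by (auto intro!: mult_lt_le)
  then have "j b ^ 2 \<prec> j e ^ 2" "j e ^ 2 \<prec> j a ^ 2"
    using same_lt[OF same_refl e, of "j b ^ 2"] same_lt[OF e same_refl, of "j a ^ 2"]
    by (auto simp: power2_eq_square mult.commute)
  then have "j b \<prec> j e" "j e \<prec> j a" by (simp_all add: lt_def power_le_iff)
  then show thesis using that by blast
qed

definition cdisc :: "'k \<Rightarrow> 'k \<Rightarrow> 'k set" where "cdisc a c = {d. j (d - c) \<preceq> j a}"

definition odisc :: "'k \<Rightarrow> 'k \<Rightarrow> 'k set" where "odisc a c = {d. j (d - c) \<prec> j a}"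

lemma cdisc_center: "d \<in> cdisc a c \<Longrightarrow> cdisc a c = cdisc a d"
proof -
  have "cdisc a c \<subseteq> cdisc a d" if "d \<in> cdisc a c" for c d
  proof
    fix x assume "x \<in> cdisc a c"
    then have "j (x - c) - j (d - c) \<preceq> j a" using that by (intro diff_le) (auto simp: cdisc_def)
    then show "x \<in> cdisc a d" by (simp add: cdisc_def)
  qed
  moreover have "c \<in> cdisc a d" if "d \<in> cdisc a c" for c d
    using that diff_commute_le[of "j c" "j d" "j a"] by (simp add: cdisc_def)
  ultimately show "d \<in> cdisc a c \<Longrightarrow> cdisc a c = cdisc a d" by blast
qed

lemma odisc_center: "d \<in> odisc a c \<Longrightarrow> odisc a c = odisc a d"
proof -
  have "odisc a c \<subseteq> odisc a d" if "d \<in> odisc a c" for c d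
  proof
    fix x assume "x \<in> odisc a c"
    then have "j (x - c) - j (d - c) \<prec> j a" using that by (intro diff_lt) (auto simp: odisc_def)
    then show "x \<in> odisc a d" by (simp add: odisc_def)
  qed
  moreover have "c \<in> odisc a d" if "d \<in> odisc a c" for c d
    using that diff_commute_lt[of "j c" "j d" "j a"] by (simp add: odisc_def)
  ultimately show "d \<in> odisc a c \<Longrightarrow> odisc a c = odisc a d" by blast
qed

text \<open>
  In this form the previous result applies to finitely many balls of any size and kind.
\<close>

lemma closed_ball_avoid:
  assumes a: "a \<noteq> 0" and N: "finite N" "\<And>B. B \<in> N \<Longrightarrow> \<exists>c'. B \<inter> cdisc a c \<subseteq> odisc a c'"
  obtains d where "d \<in> cdisc a c" "d \<notin> \<Union>N"
proof -
  obtain f where f: "\<And>B. B \<in> N \<Longrightarrow> B \<inter> cdisc a c \<subseteq> odisc a (f B)" using N(2) by metis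
  obtain d where d: "j (d - c) \<preceq> j a" "\<And>e. e \<in> f ` N \<Longrightarrow> j a \<preceq> j (d - e)"
    using closed_ball_not_covered[OF a finite_imageI[OF N(1)]] by blast
  have "d \<notin> B" if "B \<in> N" for B
    using f[OF that] d that by (auto simp: cdisc_def odisc_def lt_def)
  then show thesis using that d(1) by (auto simp: cdisc_def)
qed

end

text \<open>
  A possibly empty nest of balls. Radii are absolute values of elements \<open>a\<close> of \<open>K\<close>, and the
  predicates \<open>has_closed a c\<close> and \<open>has_open a c\<close> say that the ball of radius \<open>\<bar>a\<bar>\<close> around \<open>c\<close> belongs
  to the nest. Balls of radius \<open>0\<close>, which are the closed balls of additive radius \<open>\<infinity>\<close>, are left out;
  no nontrivial approximation type contains them.
\<close>

locale nest = dense_valued below j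
  for below :: "'l::alg_closed_field \<Rightarrow> 'l \<Rightarrow> bool" (infix "\<preceq>" 50) and j :: "'k::field \<Rightarrow> 'l" +
  fixes has_closed has_open :: "'k \<Rightarrow> 'k \<Rightarrow> bool"
  assumes closed_center: "a \<noteq> 0 \<Longrightarrow> has_closed a c \<Longrightarrow> d \<in> cdisc a c \<Longrightarrow> has_closed a d"
    and open_center: "a \<noteq> 0 \<Longrightarrow> has_open a c \<Longrightarrow> d \<in> odisc a c \<Longrightarrow> has_open a d"
    and closed_mono: "a \<noteq> 0 \<Longrightarrow> has_closed a c \<Longrightarrow> j a \<preceq> j b \<Longrightarrow> has_closed b c"
    and closed_imp_open: "a \<noteq> 0 \<Longrightarrow> has_closed a c \<Longrightarrow> j a \<prec> j b \<Longrightarrow> has_open b c"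
    and open_imp_closed: "a \<noteq> 0 \<Longrightarrow> has_open a c \<Longrightarrow> has_closed a c"
    and open_mono: "a \<noteq> 0 \<Longrightarrow> has_open a c \<Longrightarrow> j a \<preceq> j b \<Longrightarrow> has_open b c"
    and chain: "B \<in> {cdisc a c | a c. a \<noteq> 0 \<and> has_closed a c} \<union> {odisc a c | a c. a \<noteq> 0 \<and> has_open a c} \<Longrightarrow>
      B' \<in> {cdisc a c | a c. a \<noteq> 0 \<and> has_closed a c} \<union> {odisc a c | a c. a \<noteq> 0 \<and> has_open a c} \<Longrightarrow> B \<subseteq> B' \<or> B' \<subseteq> B"
begin

definition inside :: "'k set set" where
  "inside = {cdisc a c | a c. a \<noteq> 0 \<and> has_closed a c} \<union> {odisc a c | a c. a \<noteq> 0 \<and> has_open a c}"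

text \<open>
  The singletons are there to keep the ultrafilter below from being principal, so that no nonzero
  polynomial vanishes along it.
\<close>

definition outside :: "'k set set" where
  "outside = {cdisc a c | a c. a \<noteq> 0 \<and> \<not> has_closed a c} \<union> {odisc a c | a c. a \<noteq> 0 \<and> \<not> has_open a c} \<union> {{c} | c. True}"

lemma outside_cases:
  assumes "B \<in> outside" "d \<in> B"
  obtains b where "b \<noteq> 0" "B = cdisc b d" "\<not> has_closed b d" | b where "b \<noteq> 0" "B = odisc b d" "\<not> has_open b d" | "B = {d}"
proof -
  consider b c where "b \<noteq> 0" "B = cdisc b c" "\<not> has_closed b c" | b c where "b \<noteq> 0" "B = odisc b c" "\<not> has_open b c" | c where "B = {c}"
    using assms(1) by (auto simp: outside_def)
  then show thesis
  proof cases
    case 1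
    then have "B = cdisc b d" using cdisc_center assms(2) by blast
    moreover have "c \<in> cdisc b c" by (simp add: cdisc_def zero_le)
    ultimately have "B = cdisc b d" "c \<in> cdisc b d" using 1 by auto
    then show thesis using that(1)[of b] 1 closed_center by blast
  next
    case 2
    then have "B = odisc b d" using odisc_center assms(2) by blast
    moreover have "c \<in> odisc b c" using 2 by (simp add: odisc_def)
    ultimately have "B = odisc b d" "c \<in> odisc b d" using 2 by auto
    then show thesis using that(2)[of b] 2 open_center by blast
  next
    case 3
    then show thesis using that(3) assms(2) by blast
  qed
qed

text \<open>
  A ball that does not belong to the nest but meets one that does cannot contain it, so it is a
  proper subball.
\<close>

lemma outside_in_closed:
  assumes a: "a \<noteq> 0" "has_closed a c" and B: "B \<in> outside"
  shows "\<exists>c'. B \<inter> cdisc a c \<subseteq> odisc a c'"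
proof (cases "B \<inter> cdisc a c = {}")
  case False
  then obtain d where d: "d \<in> B" "d \<in> cdisc a c" by blast
  then have has_closed: "has_closed a d" using closed_center a by blast
  from B d(1) have "B \<subseteq> odisc a d"
  proof (cases rule: outside_cases)
    case (1 b)
    then have "j b \<prec> j a" using closed_mono[OF a(1) has_closed] by (auto simp: lt_def)
    then show ?thesis using 1 by (auto simp: cdisc_def odisc_def intro: le_lt_trans)
  next
    case (2 b)
    then have "j b \<preceq> j a" using closed_imp_open[OF a(1) has_closed] by (auto simp: lt_def)
    then show ?thesis using 2 by (auto simp: odisc_def intro: lt_le_trans)
  qed (use a in \<open>auto simp: odisc_def\<close>)
  then show ?thesis by blast
qed auto

text \<open>
  A proper subball of an open ball has a strictly smaller radius, whereas one of a closed ball may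
  be open of the same radius. Nontriviality supplies a radius for the singletons.
\<close>

lemma outside_in_open:
  assumes a: "a \<noteq> 0" "has_open a c" and B: "B \<in> outside" and nontriv: "t \<noteq> 0" "j t \<prec> 1"
  shows "\<exists>b c'. b \<noteq> 0 \<and> j b \<prec> j a \<and> B \<inter> odisc a c \<subseteq> cdisc b c'"
proof -
  have ta: "t * a \<noteq> 0" "j (t * a) \<prec> j a"
    using a nontriv mult_lt_le[OF nontriv(2), of "j a" "j a"] by auto
  show ?thesis
  proof (cases "B \<inter> odisc a c = {}")
    case True
    then show ?thesis using ta by blast
  next
    case False
    then obtain d where d: "d \<in> B" "d \<in> odisc a c" by blast
    then have has_open: "has_open a d" using open_center a by blast
    from B d(1) show ?thesis
    proof (cases rule: outside_cases)
      case (1 b)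
      then have "j b \<prec> j a" using open_imp_closed[OF a(1) has_open] closed_mono[OF a(1), of d b] by (auto simp: lt_def)
      then show ?thesis using 1 by blast
    next
      case (2 b)
      then have "j b \<prec> j a" using open_mono[OF a(1) has_open] by (auto simp: lt_def)
      moreover have "odisc b d \<subseteq> cdisc b d" by (auto simp: odisc_def cdisc_def lt_imp_le)
      ultimately show ?thesis using 2 by blast
    next
      case 3
      then have "B \<subseteq> cdisc (t * a) d" by (auto simp: cdisc_def zero_le)
      then show ?thesis using ta by blast
    qed
  qed
qed

text \<open>
  This takes care of the empty nest, where the balls of the nest do not confine the point to be
  found: all the balls to be avoided are put into open balls of one common large radius \<open>\<bar>a\<bar>\<close>, and
  then a point of a closed ball of radius \<open>\<bar>a\<bar>\<close> is chosen.
\<close>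

lemma outside_bounded:
  assumes nontriv: "t \<noteq> 0" "j t \<prec> 1" and N: "finite N" "N \<subseteq> outside"
  shows "\<exists>a. a \<noteq> 0 \<and> (\<forall>B\<in>N. \<exists>c'. B \<subseteq> odisc a c')"
  using N
proof induction
  case empty
  show ?case by (intro exI[of _ 1]) auto
next
  case (insert B N)
  then obtain a where a: "a \<noteq> 0" "\<forall>B\<in>N. \<exists>c'. B \<subseteq> odisc a c'" by auto
  have "\<exists>b c'. b \<noteq> 0 \<and> B \<subseteq> cdisc b c'"
  proof -
    have "odisc b d \<subseteq> cdisc b d" "{d} \<subseteq> cdisc 1 d" for b d by (auto simp: odisc_def cdisc_def lt_imp_le zero_le)
    note sub = this
    consider b c where "b \<noteq> 0" "B = cdisc b c" | b c where "b \<noteq> 0" "B = odisc b c" | c where "B = {c}"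
      using insert.prems by (auto simp: outside_def)
    then show ?thesis using sub by cases (blast, blast, metis zero_neq_one)
  qed
  then obtain b c' where b: "b \<noteq> 0" "B \<subseteq> cdisc b c'" by blast
  have "\<exists>e. e \<noteq> 0 \<and> j a \<preceq> j e \<and> j b \<preceq> j e"
    using total[of "j a" "j b"] a(1) b(1) refl by blast
  then obtain e where e: "e \<noteq> 0" "j a \<preceq> j e" "j b \<preceq> j e" by blast
  have lt: "j e \<prec> j (e / t)"
    using nontriv e(1) mult_lt_le[OF nontriv(2), of "j (e / t)" "j (e / t)"] by simp
  have "odisc a c \<subseteq> odisc (e / t) c" for c
    using lt_le_trans[OF _ trans[OF e(2) lt_imp_le[OF lt]]] by (auto simp: odisc_def)
  moreover have "cdisc b c \<subseteq> odisc (e / t) c" for c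
    using le_lt_trans[OF trans[OF _ e(3)] lt] by (auto simp: odisc_def cdisc_def)
  ultimately have "\<forall>B\<in>insert B N. \<exists>c'. B \<subseteq> odisc (e / t) c'"
    using a(2) b(2) by (metis insert_iff order_trans)
  then show ?case using e(1) nontriv(1) by (intro exI[of _ "e / t"]) auto
qed

lemma fip:
  assumes nontriv: "t \<noteq> 0" "j t \<prec> 1" and P: "finite P" "P \<subseteq> inside" and N: "finite N" "N \<subseteq> outside"
  obtains d where "d \<in> \<Inter>P" "d \<notin> \<Union>N"
proof (cases "inside = {}")
  case True
  then have "P = {}" using P by simp
  obtain a where a: "a \<noteq> 0" "\<And>B. B \<in> N \<Longrightarrow> \<exists>c'. B \<subseteq> odisc a c'"
    using outside_bounded[OF nontriv N] by blast
  then have "\<exists>c'. B \<inter> cdisc a 0 \<subseteq> odisc a c'" if "B \<in> N" for B using that by blast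
  then obtain d where "d \<notin> \<Union>N" using closed_ball_avoid[OF a(1) N(1)] by metis
  then show thesis using that \<open>P = {}\<close> by simp
next
  case False
  have "\<exists>M\<in>inside. \<forall>B\<in>P. M \<subseteq> B"
    using P
  proof induction
    case (insert B P)
    then obtain M where "M \<in> inside" "\<forall>B\<in>P. M \<subseteq> B" by auto
    moreover have "M \<subseteq> B \<or> B \<subseteq> M"
      using calculation(1) insert.prems chain unfolding inside_def by (meson insert_subset)
    ultimately show ?case using insert.prems by (metis (no_types, lifting) insert_iff insert_subset order_trans subset_refl)
  qed (use False in auto)
  then obtain M where M: "M \<in> inside" "M \<subseteq> \<Inter>P" by blast
  have "\<exists>d. d \<in> M \<and> d \<notin> \<Union>N"
  proof -
    consider a c where "a \<noteq> 0" "has_closed a c" "M = cdisc a c" | a c where "a \<noteq> 0" "has_open a c" "M = odisc a c"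
      using M(1) by (auto simp: inside_def)
    then show ?thesis
    proof cases
      case 1
      have "\<And>B. B \<in> N \<Longrightarrow> \<exists>c'. B \<inter> cdisc a c \<subseteq> odisc a c'"
        using outside_in_closed[OF 1(1,2)] N(2) by blast
      then show ?thesis using closed_ball_avoid[OF 1(1) N(1)] 1(3) by metis
    next
      case 2
      have "\<exists>b. b \<noteq> 0 \<and> j b \<prec> j a \<and> (\<forall>B\<in>N. \<exists>c'. B \<inter> odisc a c \<subseteq> cdisc b c')"
        using N
      proof induction
        case empty
        have "j (t * a) \<prec> j a" using 2(1) mult_lt_le[OF nontriv(2), of "j a" "j a"] by simp
        then show ?case using 2(1) nontriv(1) by (intro exI[of _ "t * a"]) auto
      next
        case (insert B N)
        then obtain b where b: "b \<noteq> 0" "j b \<prec> j a" "\<forall>B\<in>N. \<exists>c'. B \<inter> odisc a c \<subseteq> cdisc b c'" by auto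
        obtain b' c' where b': "b' \<noteq> 0" "j b' \<prec> j a" "B \<inter> odisc a c \<subseteq> cdisc b' c'"
          using outside_in_open[OF 2(1,2) _ nontriv] insert.prems by blast
        have "\<exists>e. e \<noteq> 0 \<and> j e \<prec> j a \<and> j b \<preceq> j e \<and> j b' \<preceq> j e"
          using total[of "j b" "j b'"] b b' refl by blast
        then obtain e where e: "e \<noteq> 0" "j e \<prec> j a" "j b \<preceq> j e" "j b' \<preceq> j e" by blast
        have "cdisc b d \<subseteq> cdisc e d" "cdisc b' d \<subseteq> cdisc e d" for d using e trans by (auto simp: cdisc_def)
        then have "\<forall>B\<in>insert B N. \<exists>c'. B \<inter> odisc a c \<subseteq> cdisc e c'"
          using b(3) b'(3) by (metis insert_iff order_trans)
        then show ?case using e by blast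
      qed
      then obtain b where b: "b \<noteq> 0" "j b \<prec> j a" "\<And>B. B \<in> N \<Longrightarrow> \<exists>c'. B \<inter> odisc a c \<subseteq> cdisc b c'" by blast
      \<comment> \<open>A radius strictly between reduces the open ball to a closed one, whose subballs are small enough.\<close>
      obtain e where e: "j b \<prec> j e" "j e \<prec> j a" using value_between b by blast
      have "e \<noteq> 0" using e(1) by (auto simp: lt_def zero_le)
      have sub: "cdisc e c \<subseteq> odisc a c" "cdisc b d \<subseteq> odisc e d" for d
        using e le_lt_trans by (auto simp: cdisc_def odisc_def)
      have "\<exists>c'. B \<inter> cdisc e c \<subseteq> odisc e c'" if "B \<in> N" for B using b(3)[OF that] sub by blast
      then obtain d where "d \<in> cdisc e c" "d \<notin> \<Union>N" using closed_ball_avoid[OF \<open>e \<noteq> 0\<close> N(1)] by metis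
      then show ?thesis using sub 2(3) by blast
    qed
  qed
  then show thesis using that M(2) by blast
qed

text \<open>
  For \<open>x\<close> to lie in a ball around \<open>c\<close> is a comparison of \<open>x - c\<close> with the radius, so this is the
  existence problem in terms of relations on \<open>K[x]\<close>.
\<close>

definition realizes :: "('k poly \<Rightarrow> 'k poly \<Rightarrow> bool) \<Rightarrow> bool" where
  "realizes R \<longleftrightarrow> valuative R \<and> (\<forall>a b. R [:a:] [:b:] \<longleftrightarrow> j a \<preceq> j b) \<and>
     (\<forall>a c. a \<noteq> 0 \<longrightarrow> (R [:- c, 1:] [:a:] \<longleftrightarrow> has_closed a c) \<and> (\<not> R [:a:] [:- c, 1:] \<longleftrightarrow> has_open a c))"

text \<open>
  The absolute value of \<open>f\<close> is the germ of \<open>d \<mapsto> \<bar>f(d)\<bar>\<close> along the ultrafilter. Evaluated at \<open>x - c\<close>, it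
  says that \<open>x\<close> lies in a ball around \<open>c\<close> if and only if almost all \<open>d\<close> do.
\<close>

lemma realizes_nontrivial:
  assumes nontriv: "t \<noteq> 0" "j t \<prec> 1"
  shows "\<exists>R. realizes R"
proof -
  let ?family = "inside \<union> uminus ` outside"
  have "\<Inter>Y \<noteq> {}" if Y: "finite Y" "Y \<subseteq> ?family" for Y
  proof -
    have 1: "Y \<inter> inside \<subseteq> inside" "uminus ` (Y - inside) \<subseteq> outside" using Y(2) by auto
    obtain d where d: "d \<in> \<Inter>(Y \<inter> inside)" "d \<notin> \<Union>(uminus ` (Y - inside))"
      using fip[OF nontriv _ 1(1) _ 1(2)] Y(1) by blast
    have "d \<in> \<Inter>Y" using d by auto
    then show ?thesis by blast
  qed
  then obtain U where U: "U \<noteq> bot" "\<And>P. eventually P U \<or> eventually (\<lambda>x. \<not> P x) U"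
    "\<And>S. S \<in> ?family \<Longrightarrow> eventually (\<lambda>x. x \<in> S) U"
    using fip_ultrafilter[of ?family] by blast
  have out: "- S \<in> ?family" if "S \<in> outside" for S using that by blast
  have const: "eventually (\<lambda>x. P) U \<longleftrightarrow> P" for P using eventually_const[OF U(1)] .
  have excl: "\<not> (eventually P U \<and> eventually (\<lambda>x. \<not> P x) U)" for P
    using eventually_conj[of P U "\<lambda>x. \<not> P x"] const[of False] by auto
  have nonzero: "eventually (\<lambda>d. poly f d \<noteq> 0) U" if "f \<noteq> 0" for f
  proof -
    have "eventually (\<lambda>d. \<forall>c\<in>{c. poly f c = 0}. d \<noteq> c) U"
    proof (rule eventually_ball_finite)
      show "finite {c. poly f c = 0}" using that by (rule poly_roots_finite)
      have "- {c} \<in> ?family" for c by (rule out) (auto simp: outside_def)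
      from U(3)[OF this] show "\<forall>c\<in>{c. poly f c = 0}. eventually (\<lambda>d. d \<noteq> c) U" by simp
    qed
    then show ?thesis by eventually_elim auto
  qed
  define R where "R f g \<longleftrightarrow> eventually (\<lambda>d. j (poly f d) \<preceq> j (poly g d)) U" for f g
  have "valuative R"
  proof
    fix a b c :: "'k poly"
    show "R a b \<or> R b a"
      using U(2)[of "\<lambda>d. j (poly a d) \<preceq> j (poly b d)"]
    proof
      assume "eventually (\<lambda>d. \<not> j (poly a d) \<preceq> j (poly b d)) U"
      then have "R b a" unfolding R_def by (rule eventually_mono) (use total in blast)
      then show ?thesis ..
    qed (simp add: R_def)
    show "R a b \<Longrightarrow> R b c \<Longrightarrow> R a c"
      unfolding R_def by (erule (1) eventually_elim2) (rule trans)
    show "R 0 a" by (simp add: R_def zero_le)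
    show "R a 0 \<Longrightarrow> a = 0"
      using nonzero[of a] excl[of "\<lambda>d. poly a d = 0"] by (auto simp: R_def)
    show "R (a * c) (b * c) \<longleftrightarrow> R a b" if "c \<noteq> 0"
      unfolding R_def
      by (rule eventually_cong[OF nonzero[OF that]]) (simp add: mult_right)
    show "R a c \<Longrightarrow> R b c \<Longrightarrow> R (a + b) c"
      unfolding R_def by (erule (1) eventually_elim2) (simp add: add_le)
  qed
  moreover have "R [:a:] [:b:] \<longleftrightarrow> j a \<preceq> j b" for a b by (simp add: R_def const)
  moreover have "R [:- c, 1:] [:a:] \<longleftrightarrow> has_closed a c" if a: "a \<noteq> 0" for a c
  proof -
    have R: "R [:- c, 1:] [:a:] \<longleftrightarrow> eventually (\<lambda>d. d \<in> cdisc a c) U" by (simp add: R_def cdisc_def)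
    show ?thesis
    proof (cases "has_closed a c")
      case True
      then have "cdisc a c \<in> inside" using a by (auto simp: inside_def)
      then show ?thesis using True R U(3)[of "cdisc a c"] by simp
    next
      case False
      then have "cdisc a c \<in> outside" using a by (auto simp: outside_def)
      then have "eventually (\<lambda>d. \<not> d \<in> cdisc a c) U" using U(3)[OF out] by simp
      then show ?thesis using False R excl[of "\<lambda>d. d \<in> cdisc a c"] by blast
    qed
  qed
  moreover have "\<not> R [:a:] [:- c, 1:] \<longleftrightarrow> has_open a c" if a: "a \<noteq> 0" for a c
  proof -
    have R: "R [:a:] [:- c, 1:] \<longleftrightarrow> eventually (\<lambda>d. \<not> d \<in> odisc a c) U"
      by (simp add: R_def odisc_def not_lt)
    show ?thesis
    proof (cases "has_open a c")
      case True
      then have "odisc a c \<in> inside" using a by (auto simp: inside_def)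
      then have "eventually (\<lambda>d. d \<in> odisc a c) U" using U(3)[of "odisc a c"] by simp
      then show ?thesis using True R excl[of "\<lambda>d. d \<in> odisc a c"] by blast
    next
      case False
      then have "odisc a c \<in> outside" using a by (auto simp: outside_def)
      then show ?thesis using False R U(3)[OF out, of "odisc a c"] by simp
    qed
  qed
  ultimately have "realizes R" by (simp add: realizes_def)
  then show ?thesis by blast
qed

end

text \<open>
  The relation of a valuation \<open>\<phi>\<close> with integer values, whose value at \<open>0\<close> is ignored.
\<close>

definition int_val_le :: "('a::idom \<Rightarrow> int) \<Rightarrow> 'a \<Rightarrow> 'a \<Rightarrow> bool" where
  "int_val_le \<phi> f g \<longleftrightarrow> f = 0 \<or> (g \<noteq> 0 \<and> \<phi> g \<le> \<phi> f)"

lemma valuative_int_val_le: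
  assumes "\<And>f g. f \<noteq> 0 \<Longrightarrow> g \<noteq> 0 \<Longrightarrow> \<phi> (f * g) = \<phi> f + \<phi> g"
    and "\<And>f g. f \<noteq> 0 \<Longrightarrow> g \<noteq> 0 \<Longrightarrow> f + g \<noteq> 0 \<Longrightarrow> min (\<phi> f) (\<phi> g) \<le> \<phi> (f + g)"
  shows "valuative (int_val_le \<phi>)"
proof
  fix a b c
  show "int_val_le \<phi> a c \<Longrightarrow> int_val_le \<phi> b c \<Longrightarrow> int_val_le \<phi> (a + b) c"
    using assms(2)[of a b]
    by (cases "a = 0"; cases "b = 0"; cases "a + b = 0")
      (auto simp: int_val_le_def min_le_iff_disj intro: order_trans)
qed (auto simp: int_val_le_def assms(1))

context nest
begin

text \<open>
  Over a trivially valued field the open ball around \<open>c\<close> is \<open>{c}\<close> and the closed ball is everything.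
  A nest that contains \<open>{c}\<close> belongs to the order of vanishing at \<open>c\<close>, one that contains only the
  whole field to the trivial valuation, and the empty nest to the negative degree.
\<close>

lemma realizes_trivial:
  assumes triv: "\<And>t. t \<noteq> 0 \<Longrightarrow> \<not> j t \<prec> 1"
  shows "\<exists>R. realizes R"
proof -
  have unit: "j a \<asymp> 1" if "a \<noteq> 0" for a
  proof -
    have "1 \<preceq> j (inverse a)" "1 \<preceq> j a" using triv[of "inverse a"] triv[of a] that by (auto simp: not_lt)
    then have "1 * j a \<preceq> j (inverse a) * j a" by (intro mult_mono) auto
    also have "j (inverse a) * j a = 1" using that by (simp flip: j_mult)
    finally show ?thesis using \<open>1 \<preceq> j a\<close> by (simp add: same_def)
  qed
  have le: "j a \<preceq> j b \<longleftrightarrow> a = 0 \<or> b \<noteq> 0" for a b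
    using unit[of a] unit[of b] zero_le by (cases "a = 0"; cases "b = 0") (auto simp: same_def intro: trans)
  have cdisc: "cdisc a c = UNIV" and odisc: "odisc a c = {c}" if "a \<noteq> 0" for a c
    using that le by (auto simp: cdisc_def odisc_def lt_def simp del: j_diff)
  have main: "realizes (int_val_le \<phi>)"
    if \<phi>: "\<And>f g. f \<noteq> 0 \<Longrightarrow> g \<noteq> 0 \<Longrightarrow> \<phi> (f * g) = \<phi> f + \<phi> g"
    "\<And>f g. f \<noteq> 0 \<Longrightarrow> g \<noteq> 0 \<Longrightarrow> f + g \<noteq> 0 \<Longrightarrow> min (\<phi> f) (\<phi> g) \<le> \<phi> (f + g)"
    "\<And>a. a \<noteq> 0 \<Longrightarrow> \<phi> [:a:] = 0"
    and has_closed: "\<And>a c. a \<noteq> 0 \<Longrightarrow> has_closed a c \<longleftrightarrow> \<phi> [:- c, 1:] \<ge> 0"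
    and has_open: "\<And>a c. a \<noteq> 0 \<Longrightarrow> has_open a c \<longleftrightarrow> \<phi> [:- c, 1:] > 0" for \<phi>
    unfolding realizes_def using valuative_int_val_le[of \<phi>] \<phi> has_closed has_open by (auto simp: int_val_le_def le)
  have closed_const: "has_closed a c \<longleftrightarrow> has_closed 1 d" if "a \<noteq> 0" for a c d
    using closed_center[of a c d] closed_center[of 1 d c] closed_mono[of a d 1] closed_mono[of 1 c a] le[of 1 a] le[of a 1] cdisc that by auto
  have open_const: "has_open a c \<longleftrightarrow> has_open 1 c" if "a \<noteq> 0" for a c
    using open_mono[of a c 1] open_mono[of 1 c a] le[of 1 a] le[of a 1] that by auto
  consider c where "has_open 1 c" | "\<And>c. \<not> has_open 1 c" "\<And>c. has_closed 1 c" | "\<And>c. \<not> has_open 1 c" "\<And>c. \<not> has_closed 1 c"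
    using closed_const[of 1] by (metis zero_neq_one)
  then show ?thesis
  proof cases
    case (1 c)
    have "has_closed 1 c" using 1 open_imp_closed by auto
    have uniq: "has_open 1 d \<longleftrightarrow> d = c" for d
    proof
      assume "has_open 1 d"
      have "odisc 1 c \<subseteq> odisc 1 d \<or> odisc 1 d \<subseteq> odisc 1 c"
        by (rule chain) (use 1 \<open>has_open 1 d\<close> in force)+
      then show "d = c" using odisc by auto
    qed (use 1 in simp)
    have lin: "Polynomial.order c [:- d, 1:] = (if d = c then 1 else 0)" for d
      using order_power_n_n[of c 1] order_0I[of "[:-d, 1:]" c] by auto
    have "realizes (int_val_le (\<lambda>f. int (Polynomial.order c f)))"
    proof (rule main)
      fix f g :: "'k poly" assume fg: "f \<noteq> 0" "g \<noteq> 0" "f + g \<noteq> 0"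
      let ?m = "min (Polynomial.order c f) (Polynomial.order c g)"
      have "[:- c, 1:] ^ ?m dvd f" "[:- c, 1:] ^ ?m dvd g" by (simp_all add: order_divides)
      then have "[:- c, 1:] ^ ?m dvd f + g" by (rule dvd_add)
      then show "min (int (Polynomial.order c f)) (int (Polynomial.order c g)) \<le> int (Polynomial.order c (f + g))"
        using fg(3) by (simp add: order_divides)
    next
      fix a d :: 'k assume "a \<noteq> 0"
      show "has_closed a d \<longleftrightarrow> int (Polynomial.order c [:- d, 1:]) \<ge> 0" using closed_const[OF \<open>a \<noteq> 0\<close>] \<open>has_closed 1 c\<close> by auto
      show "has_open a d \<longleftrightarrow> int (Polynomial.order c [:- d, 1:]) > 0" using open_const[OF \<open>a \<noteq> 0\<close>] uniq lin by auto
    qed (auto simp: order_mult order_0I)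
    then show ?thesis by blast
  next
    case 2
    have "realizes (int_val_le (\<lambda>f. 0))"
    proof (rule main)
      fix a c :: 'k assume "a \<noteq> 0"
      then show "has_closed a c \<longleftrightarrow> (0::int) \<le> 0" "has_open a c \<longleftrightarrow> (0::int) < 0"
        using 2 closed_const[of a c c] open_const[of a c] by auto
    qed auto
    then show ?thesis by blast
  next
    case 3
    have "realizes (int_val_le (\<lambda>f. - int (Polynomial.degree f)))"
    proof (rule main)
      fix f g :: "'k poly"
      show "min (- int (Polynomial.degree f)) (- int (Polynomial.degree g)) \<le> - int (Polynomial.degree (f + g))"
        using degree_add_le_max[of f g] by linarith
    next
      fix a c :: 'k assume "a \<noteq> 0"
      then show "has_closed a c \<longleftrightarrow> - int (Polynomial.degree [:- c, 1:]) \<ge> 0" "has_open a c \<longleftrightarrow> - int (Polynomial.degree [:- c, 1:]) > 0"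
        using 3 closed_const[of a c c] open_const[of a c] by auto
    qed (auto simp: degree_mult_eq)
    then show ?thesis by blast
  qed
qed

theorem ex_realizes: "\<exists>R. realizes R"
  using realizes_trivial realizes_nontrivial by blast

end

section \<open>Approximation types of extensions\<close>

text \<open>
  Every element of the algebraic closure is a root of a polynomial over \<open>K\<close>, and this polynomial
  splits into linear factors already over \<open>K\<close>.
\<close>

lemma surj_to_ac:
  fixes a :: "'k::field alg_closure"
  assumes closed: "\<And>p :: 'k poly. 0 < Polynomial.degree p \<Longrightarrow> \<exists>z. poly p z = 0"
  shows "\<exists>c. to_ac c = a"
proof -
  obtain p where "p \<noteq> 0" "poly (map_poly to_ac p) a = 0" by (rule alg_closure_algebraic)
  then show ?thesis
  proof (induction "Polynomial.degree p" arbitrary: p rule: less_induct)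
    case (less p)
    show ?case
    proof (cases "Polynomial.degree p = 0")
      case True
      then obtain c where "p = [:c:]" by (elim degree_eq_zeroE)
      then show ?thesis using less.prems by (simp add: map_poly_pCons)
    next
      case False
      then obtain z where "poly p z = 0" using closed by blast
      then obtain q where q: "p = [:- z, 1:] * q" by (auto simp: poly_eq_0_iff_dvd elim: dvdE)
      have "map_poly to_ac p = [:- to_ac z, 1:] * map_poly to_ac q"
        by (rule poly_eqI) (simp add: q coeff_map_poly coeff_pCons split: nat.split)
      then have "(a - to_ac z) * poly (map_poly to_ac q) a = 0"
        using less.prems(2) by auto
      moreover have "q \<noteq> 0" using less.prems(1) q by auto
      moreover from this have "Polynomial.degree q < Polynomial.degree p"
        unfolding q by (subst degree_mult_eq) auto
      ultimately show ?thesis using less.hyps[of q] by (cases "a = to_ac z") auto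
    qed
  qed
qed

text \<open>
  If \<open>K\<close> is algebraically closed, then \<open>to_ac\<close> is onto and \<open>v\<^sub>0\<close> itself becomes a valuation of the
  closure.
\<close>

lemma dense_valued_closure:
  fixes v0 :: "'k::field \<Rightarrow> 'g ext"
  assumes v0: "valuation G v0"
    and dense: "(\<forall>p :: 'k poly. 0 < Polynomial.degree p \<longrightarrow> (\<exists>z. poly p z = 0)) \<or>
         dense_in_alg_closure TYPE('w) G v0"
  obtains r where "dense_valued r (to_ac :: 'k \<Rightarrow> _)" "\<And>a b. r (to_ac a) (to_ac b) \<longleftrightarrow> val_le G v0 a b"
  using dense
proof
  assume closed: "\<forall>p :: 'k poly. 0 < Polynomial.degree p \<longrightarrow> (\<exists>z. poly p z = 0)"
  have surj: "\<exists>c. to_ac c = a" for a :: "'k alg_closure"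
    using surj_to_ac closed by blast
  have oa: "to_ac (of_ac a) = a" for a :: "'k alg_closure"
    using surj[of a] by (intro to_ac_of_ac) auto
  define r where "r a b \<longleftrightarrow> val_le G v0 (of_ac a) (of_ac b)" for a b :: "'k alg_closure"
  interpret V: valuative "val_le G v0" using v0 by (rule valuative_valuation)
  have "valuative r"
    unfolding r_def
  proof (rule V.pullback)
    fix a b :: "'k alg_closure"
    show "of_ac a = 0 \<longleftrightarrow> a = 0" by (metis oa of_ac_0 to_ac_0)
    show "of_ac (a * b) = of_ac a * of_ac b" by (metis oa of_ac_to_ac to_ac_mult)
    show "of_ac (a + b) = of_ac a + of_ac b" by (metis oa of_ac_to_ac to_ac_add)
  qed
  then interpret valuative r .
  have "dense_valued r to_ac"
  proof
    fix x y :: "'k alg_closure" assume "y \<noteq> 0"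
    then show "\<exists>c. lt (x - to_ac c) y"
      by (intro exI[of _ "of_ac x"]) (simp add: oa)
  qed auto
  then show thesis using that by (simp add: r_def)
next
  assume "dense_in_alg_closure TYPE('w) G v0"
  then obtain H \<iota> and w :: "'k alg_closure \<Rightarrow> 'w ext" where
    E: "(H, \<iota>, w) \<in> extensions to_ac G v0"
    and d: "\<And>a \<alpha>. \<alpha> \<in> carrier H \<Longrightarrow> \<exists>c. ext_less H (Fin \<alpha>) (w (a - to_ac c))"
    unfolding dense_in_alg_closure_def by blast
  have w: "valuation H w" using E by (simp add: extensions_def)
  interpret valuative "val_le H w" using w by (rule valuative_valuation)
  have "dense_valued (val_le H w) to_ac"
  proof
    fix x y :: "'k alg_closure" assume "y \<noteq> 0"
    then obtain \<alpha> where \<alpha>: "\<alpha> \<in> carrier H" "w y = Fin \<alpha>" using valuation_finite(1)[OF w] by blast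
    then obtain c where "ext_less H (w y) (w (x - to_ac c))" using d by metis
    moreover have "ordered_ab_group H" using w by (simp add: valuation_def)
    ultimately have "lt (x - to_ac c) y"
      using ext_less_iff valuation_in_ext_carrier[OF w] by (metis lt_def val_le_def)
    then show "\<exists>c. lt (x - to_ac c) y" by blast
  qed auto
  then show thesis using that extension_val_le(2)[OF v0 E] by blast
qed

text \<open>
  From here on \<open>appr\<close> is accessed through the lemmas on its closed and open balls.
\<close>

declare appr.simps [simp del]

lemma const_fract_hom:
  "const_fract a = 0 \<longleftrightarrow> a = 0" "const_fract (a * b) = const_fract a * const_fract b"
  "const_fract (a + b) = const_fract a + const_fract b" "const_fract (a - b) = const_fract a - const_fract b"
  by (simp_all add: const_fract_def flip: to_fract_mult to_fract_add to_fract_diff)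

lemma var_minus_const: "var_fract - const_fract c = to_fract [:- c, 1:]"
  by (simp add: const_fract_def var_fract_def flip: to_fract_diff)

lemma var_neq_const: "var_fract - const_fract c \<noteq> 0"
  by (simp add: var_minus_const)

context
  fixes G :: "'g ogroup" and v0 :: "'k::field \<Rightarrow> 'g ext"
  assumes v0: "valuation G v0"
begin

context
  fixes H :: "'u ogroup" and \<iota> :: "'g \<Rightarrow> 'u" and v :: "'k poly fract \<Rightarrow> 'u ext"
  assumes E: "(H, \<iota>, v) \<in> extensions const_fract G v0"
begin

interpretation V: valuative "val_le H v" using extension_val_le(1)[OF v0 E] .

text \<open>
  Whether \<open>x\<close> lies in the closed or open ball of radius \<open>v\<^sub>0 a\<close> around \<open>c\<close>.
\<close>

abbreviation "near a c \<equiv> val_le H v (var_fract - const_fract c) (const_fract a)"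
abbreviation "nearer a c \<equiv> \<not> val_le H v (const_fract a) (var_fract - const_fract c)"

lemma ext_le_near: "ext_le H (map_ext \<iota> (v0 a)) (v (var_fract - const_fract c)) \<longleftrightarrow> near a c"
  using E by (simp add: extensions_def val_le_def)

lemma ext_less_near:
  assumes "v0 a = Fin \<gamma>"
  shows "ext_less H (Fin (\<iota> \<gamma>)) (v (var_fract - const_fract c)) \<longleftrightarrow> nearer a c"
proof -
  have v: "valuation H v" "v (const_fract a) = Fin (\<iota> \<gamma>)" using E assms by (auto simp: extensions_def)
  then have "ordered_ab_group H" by (simp add: valuation_def)
  from ext_less_iff[OF this, of "v (const_fract a)" "v (var_fract - const_fract c)"]
  show ?thesis using valuation_in_ext_carrier[OF v(1)] by (simp add: v(2)[symmetric] val_le_def)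
qed

lemma near_center:
  assumes "near a c"
  shows "near a d \<longleftrightarrow> val_le G v0 (d - c) a"
proof -
  have "near a d \<longleftrightarrow> val_le H v (const_fract (d - c)) (const_fract a)"
    using V.diff_le[OF assms, of "var_fract - const_fract d"] V.diff_le[OF assms, of "const_fract (d - c)"]
    by (auto simp: const_fract_hom(4))
  then show ?thesis using extension_val_le(2)[OF v0 E] by simp
qed

lemma nearer_center:
  assumes "nearer a c"
  shows "nearer a d \<longleftrightarrow> \<not> val_le G v0 a (d - c)"
proof -
  have c: "V.lt (var_fract - const_fract c) (const_fract a)" using assms by (simp add: V.lt_def)
  have "V.lt (var_fract - const_fract d) (const_fract a) \<longleftrightarrow> V.lt (const_fract (d - c)) (const_fract a)"
    using V.diff_lt[OF c, of "var_fract - const_fract d"] V.diff_lt[OF c, of "const_fract (d - c)"]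
    by (auto simp: const_fract_hom(4))
  then have "nearer a d \<longleftrightarrow> \<not> val_le H v (const_fract a) (const_fract (d - c))"
    by (simp add: V.lt_def)
  then show ?thesis using extension_val_le(2)[OF v0 E] by simp
qed

lemma closed_ball_eq:
  assumes "near a c"
  shows "closed_ball G v0 (v0 a) c = Closed (v0 a) {d. near a d}"
  using near_center[OF assms] by (simp add: closed_ball_def val_le_def[of G v0])

lemma open_ball_eq:
  assumes "nearer a c" "v0 a = Fin \<gamma>"
  shows "open_ball G v0 \<gamma> c = Open \<gamma> {d. nearer a d}"
proof -
  have "ext_less G (Fin \<gamma>) (v0 (d - c)) \<longleftrightarrow> nearer a d" for d
    using nearer_center[OF assms(1), of d] ext_less_iff[of G "v0 a" "v0 (d - c)"]
      valuation_in_ext_carrier[OF v0] v0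
    by (simp add: val_le_def valuation_def flip: assms(2))
  then show ?thesis by (simp add: open_ball_def)
qed

text \<open>
  Every radius is the value of some \<open>a\<close>, with \<open>a = 0\<close> for the radius \<open>\<infinity>\<close>.
\<close>

lemma appr_altdef:
  "appr const_fract G var_fract (H, \<iota>, v) =
    {Closed (v0 a) {d. near a d} | a c. near a c} \<union>
    {Open \<gamma> {d. nearer a d} | \<gamma> a c. v0 a = Fin \<gamma> \<and> nearer a c}" (is "?L = ?R")
proof (intro equalityI subsetI)
  fix B assume "B \<in> ?L"
  then consider \<gamma> where "\<gamma> \<in> ext_carrier G" "B = Closed \<gamma> {c. ext_le H (map_ext \<iota> \<gamma>) (v (var_fract - const_fract c))}"
      "{c. ext_le H (map_ext \<iota> \<gamma>) (v (var_fract - const_fract c))} \<noteq> {}"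
    | \<gamma> where "\<gamma> \<in> carrier G" "B = Open \<gamma> {c. ext_less H (Fin (\<iota> \<gamma>)) (v (var_fract - const_fract c))}"
      "{c. ext_less H (Fin (\<iota> \<gamma>)) (v (var_fract - const_fract c))} \<noteq> {}"
    unfolding appr.simps by blast
  then show "B \<in> ?R"
  proof cases
    case 1
    then obtain a where "v0 a = \<gamma>" using ext_carrier_valuation[OF v0] by metis
    then show ?thesis using 1 ext_le_near[of a] by auto
  next
    case 2
    then obtain a where "v0 a = Fin \<gamma>" using valuation_finite(2)[OF v0] by metis
    then show ?thesis using 2 ext_less_near[of a] by auto
  qed
next
  fix B assume "B \<in> ?R"
  then consider a c where "B = Closed (v0 a) {d. near a d}" "near a c"
    | \<gamma> a c where "B = Open \<gamma> {d. nearer a d}" "v0 a = Fin \<gamma>" "nearer a c" by blast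
  then show "B \<in> ?L"
  proof cases
    case 1
    then show ?thesis
      using valuation_in_ext_carrier[OF v0, of a]
      by (auto simp: appr.simps ext_le_near[symmetric])
  next
    case 2
    have "\<gamma> \<in> carrier G" using valuation_in_ext_carrier[OF v0, of a] 2(2) by (auto simp: ext_carrier_def)
    then show ?thesis using 2 by (auto simp: appr.simps ext_less_near[OF 2(2), symmetric])
  qed
qed

text \<open>
  Equal balls have equal radii, so the ball around \<open>c\<close> can be in the approximation type only by
  virtue of its own radius, and it contains its centre \<open>c\<close>.
\<close>

lemma closed_ball_in_appr: "closed_ball G v0 (v0 a) c \<in> appr const_fract G var_fract (H, \<iota>, v) \<longleftrightarrow> near a c"
proof
  assume "closed_ball G v0 (v0 a) c \<in> appr const_fract G var_fract (H, \<iota>, v)"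
  then obtain b where b: "closed_ball G v0 (v0 a) c = Closed (v0 b) {d. near b d}"
    unfolding appr_altdef by (auto simp: closed_ball_def)
  have c: "c \<in> points (closed_ball G v0 (v0 a) c)"
    using valuation_finite(3)[OF v0, of 0] by (simp add: closed_ball_def)
  have "near b c" using c unfolding b by simp
  moreover have "v0 a = v0 b" using b by (simp add: closed_ball_def)
  ultimately show "near a c" by (simp flip: ext_le_near)
next
  assume "near a c"
  then show "closed_ball G v0 (v0 a) c \<in> appr const_fract G var_fract (H, \<iota>, v)"
    unfolding appr_altdef closed_ball_eq[OF \<open>near a c\<close>] by blast
qed

lemma open_ball_in_appr:
  assumes a: "v0 a = Fin \<gamma>"
  shows "open_ball G v0 \<gamma> c \<in> appr const_fract G var_fract (H, \<iota>, v) \<longleftrightarrow> nearer a c"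
proof
  assume "open_ball G v0 \<gamma> c \<in> appr const_fract G var_fract (H, \<iota>, v)"
  then obtain b where b: "open_ball G v0 \<gamma> c = Open \<gamma> {d. nearer b d}" "v0 b = Fin \<gamma>"
    unfolding appr_altdef by (auto simp: open_ball_def)
  have c: "c \<in> points (open_ball G v0 \<gamma> c)"
    using valuation_finite(3)[OF v0, of 0] by (simp add: open_ball_def ext_less_def)
  have "nearer b c" using c unfolding b(1) by simp
  then show "nearer a c" using b(2) ext_less_near[OF a, of c] ext_less_near[of b \<gamma> c] by simp
next
  assume "nearer a c"
  then show "open_ball G v0 \<gamma> c \<in> appr const_fract G var_fract (H, \<iota>, v)"
    unfolding appr_altdef open_ball_eq[OF \<open>nearer a c\<close> a] using a by blast
qed

lemma appr_subset_balls: "appr const_fract G var_fract (H, \<iota>, v) \<subseteq> balls G v0"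
proof
  fix B assume "B \<in> appr const_fract G var_fract (H, \<iota>, v)"
  then consider a c where "B = Closed (v0 a) {d. near a d}" "near a c"
    | \<gamma> a c where "B = Open \<gamma> {d. nearer a d}" "v0 a = Fin \<gamma>" "nearer a c"
    unfolding appr_altdef by blast
  then show "B \<in> balls G v0"
  proof cases
    case 1
    then have "B = closed_ball G v0 (v0 a) c" using closed_ball_eq by simp
    then show ?thesis using valuation_in_ext_carrier[OF v0, of a] by (auto simp: balls_def)
  next
    case 2
    then have "B = open_ball G v0 \<gamma> c" using open_ball_eq by simp
    moreover have "\<gamma> \<in> carrier G" using valuation_in_ext_carrier[OF v0, of a] 2(2) by (auto simp: ext_carrier_def)
    ultimately show ?thesis by (auto simp: balls_def)
  qed
qed

text \<open>
  The points of either ball are an upward closed set for the values of \<open>x - d\<close>, and values are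
  linearly ordered.
\<close>

lemma appr_points_chain:
  assumes "B \<in> appr const_fract G var_fract (H, \<iota>, v)" "B' \<in> appr const_fract G var_fract (H, \<iota>, v)"
  shows "points B \<subseteq> points B' \<or> points B' \<subseteq> points B"
proof -
  let ?t = "\<lambda>d. var_fract - const_fract d :: 'k poly fract"
  have up: "d' \<in> points B" if B: "B \<in> appr const_fract G var_fract (H, \<iota>, v)"
    and d: "d \<in> points B" "val_le H v (?t d') (?t d)" for B d d'
  proof -
    consider a where "points B = {d. near a d}" | a where "points B = {d. nearer a d}"
      using B unfolding appr_altdef by auto
    then show ?thesis using d V.trans by cases blast+
  qed
  show ?thesis using up[OF assms(1)] up[OF assms(2)] V.total by blast
qed

lemma approx_type_appr: "approx_type G v0 (appr const_fract G var_fract (H, \<iota>, v))"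
proof -
  let ?A = "appr const_fract G var_fract (H, \<iota>, v)"
  have less: "val_le G v0 a b" "\<not> val_le G v0 b a" if "ext_less G (Fin \<beta>) (v0 a)" "v0 b = Fin \<beta>" for a b \<beta>
  proof -
    have "ordered_ab_group G" using v0 by (simp add: valuation_def)
    from ext_less_iff[OF this, of "v0 b" "v0 a"] show "\<not> val_le G v0 b a"
      using that valuation_in_ext_carrier[OF v0] by (metis val_le_def)
    show "val_le G v0 a b" using that by (simp add: val_le_def ext_less_def)
  qed
  have step: "closed_ball G v0 (Fin \<beta>) c \<in> ?A \<and> open_ball G v0 \<beta> c \<in> ?A"
    if near: "near a c" and \<beta>: "\<beta> \<in> carrier G" "ext_less G (Fin \<beta>) (v0 a)" for a c \<beta>
  proof -
    obtain b where b: "v0 b = Fin \<beta>" using valuation_finite(2)[OF v0 \<beta>(1)] by blast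
    have ab: "val_le H v (const_fract a) (const_fract b)" "\<not> val_le H v (const_fract b) (const_fract a)"
      using less[OF \<beta>(2) b] extension_val_le(2)[OF v0 E] by auto
    have "near b c" using near ab(1) by (rule V.trans)
    moreover have "nearer b c" using near ab(2) V.trans by blast
    ultimately show ?thesis using closed_ball_in_appr[of b c] open_ball_in_appr[OF b, of c] b by simp
  qed
  show ?thesis
    unfolding approx_type_def
  proof (intro conjI ballI allI impI)
    show "?A \<subseteq> balls G v0" by (rule appr_subset_balls)
    show "points B \<subseteq> points B' \<or> points B' \<subseteq> points B" if "B \<in> ?A" "B' \<in> ?A" for B B'
      using that by (rule appr_points_chain)
  next
    fix c \<gamma> \<beta> assume "\<gamma> \<in> ext_carrier G" and A: "closed_ball G v0 \<gamma> c \<in> ?A"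
      and \<beta>: "\<beta> \<in> carrier G" "ext_less G (Fin \<beta>) \<gamma>"
    then obtain a where a: "v0 a = \<gamma>" using ext_carrier_valuation[OF v0] by metis
    then have "near a c" using A closed_ball_in_appr by metis
    then show "closed_ball G v0 (Fin \<beta>) c \<in> ?A" "open_ball G v0 \<beta> c \<in> ?A"
      using step \<beta> a by auto
  next
    fix c \<gamma> assume "\<gamma> \<in> carrier G" and A: "open_ball G v0 \<gamma> c \<in> ?A"
    then obtain a where a: "v0 a = Fin \<gamma>" using valuation_finite(2)[OF v0] by metis
    then have "nearer a c" using A open_ball_in_appr by metis
    then have near: "near a c" using V.total by blast
    then show "closed_ball G v0 (Fin \<gamma>) c \<in> ?A" using closed_ball_in_appr[of a c] a by simp
    fix \<beta> assume "\<beta> \<in> carrier G" "ext_less G (Fin \<beta>) (Fin \<gamma>)"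
    then show "closed_ball G v0 (Fin \<beta>) c \<in> ?A" "open_ball G v0 \<beta> c \<in> ?A"
      using step[OF near] a by auto
  qed
qed

lemma not_trivial_appr: "\<not> trivial_type G (appr const_fract G var_fract (H, \<iota>, v))"
proof
  assume "trivial_type G (appr const_fract G var_fract (H, \<iota>, v))"
  then obtain S where "Closed Infty S \<in> appr const_fract G var_fract (H, \<iota>, v)"
    by (auto simp: trivial_type_def supp_def)
  then have "\<exists>a c. v0 a = Infty \<and> near a c" unfolding appr_altdef by (auto dest: sym)
  then obtain a c where "v0 a = Infty" "near a c" by blast
  then have "near 0 c" using valuation_finite(3)[OF v0, of a] by simp
  then have "var_fract - const_fract c = 0" using V.le_zero const_fract_hom(1)[of 0] by metis
  then show False using var_neq_const by blast
qed

end

lemma type_eqI: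
  assumes "A \<subseteq> balls G v0" "B \<subseteq> balls G v0"
    and "\<And>a c. closed_ball G v0 (v0 a) c \<in> A \<longleftrightarrow> closed_ball G v0 (v0 a) c \<in> B"
    and "\<And>a \<gamma> c. v0 a = Fin \<gamma> \<Longrightarrow> open_ball G v0 \<gamma> c \<in> A \<longleftrightarrow> open_ball G v0 \<gamma> c \<in> B"
  shows "A = B"
proof -
  have "b \<in> A \<longleftrightarrow> b \<in> B" if b: "b \<in> balls G v0" for b
  proof -
    consider \<gamma> c where "\<gamma> \<in> ext_carrier G" "b = closed_ball G v0 \<gamma> c" | \<gamma> c where "\<gamma> \<in> carrier G" "b = open_ball G v0 \<gamma> c"
      using b by (auto simp: balls_def)
    then show ?thesis
    proof cases
      case 1
      then obtain a where "v0 a = \<gamma>" using ext_carrier_valuation[OF v0] by metis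
      then show ?thesis using assms(3) 1 by auto
    next
      case 2
      then obtain a where "v0 a = Fin \<gamma>" using valuation_finite(2)[OF v0] by metis
      then show ?thesis using assms(4) 2 by auto
    qed
  qed
  then show ?thesis using assms(1,2) by blast
qed

text \<open>
  Different \<open>a\<close> with the same value give the same ball. This is why the conditions on strictly
  smaller additive radii in the definition of an approximation type yield the conditions of a nest,
  where equality of radii is allowed.
\<close>

lemma nest_approx_type:
  assumes "dense_valued r j" and r: "\<And>a b. r (j a) (j b) \<longleftrightarrow> val_le G v0 a b"
    and A: "approx_type G v0 A"
  shows "nest r j (\<lambda>a c. closed_ball G v0 (v0 a) c \<in> A) (\<lambda>a c. \<exists>\<gamma>. v0 a = Fin \<gamma> \<and> open_ball G v0 \<gamma> c \<in> A)"
proof -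
  interpret dense_valued r j by fact
  have G: "ordered_ab_group G" using v0 by (simp add: valuation_def)
  have cdisc: "cdisc a c = {d. ext_le G (v0 a) (v0 (d - c))}" for a c
    by (simp add: cdisc_def r val_le_def del: j_diff)
  have odisc: "odisc a c = {d. ext_less G (Fin \<gamma>) (v0 (d - c))}" if "v0 a = Fin \<gamma>" for a c \<gamma>
    using ext_less_iff[OF G] valuation_in_ext_carrier[OF v0] that
    by (simp add: odisc_def lt_def r val_le_def del: j_diff) metis
  have cb: "closed_ball G v0 (v0 a) c = Closed (v0 a) (cdisc a c)" for a c by (simp add: closed_ball_def cdisc)
  have ob: "open_ball G v0 \<gamma> c = Open \<gamma> (odisc a c)" if "v0 a = Fin \<gamma>" for a c \<gamma>
    using odisc[OF that] by (simp add: open_ball_def)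
  have fin: "\<exists>\<gamma>\<in>carrier G. v0 a = Fin \<gamma>" if "a \<noteq> 0" for a
    using valuation_finite(1)[OF v0 that] .
  have fin': "\<gamma> \<in> carrier G" if "v0 a = Fin \<gamma>" for a \<gamma>
    using valuation_in_ext_carrier[OF v0, of a] that by (auto simp: ext_carrier_def)
  have leq: "v0 a = v0 b \<or> ext_less G (v0 b) (v0 a)" if "r (j a) (j b)" for a b
    using that by (auto simp: r val_le_def ext_less_def)
  have less: "ext_less G (v0 b) (v0 a)" if "lt (j a) (j b)" for a b
    using that ext_less_iff[OF G] valuation_in_ext_carrier[OF v0] by (simp add: lt_def r val_le_def)
  have nz: "b \<noteq> 0" if "a \<noteq> 0" "r (j a) (j b)" for a b using that by auto
  have down: "closed_ball G v0 (v0 b) c \<in> A \<and> (\<exists>\<gamma>. v0 b = Fin \<gamma> \<and> open_ball G v0 \<gamma> c \<in> A)"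
    if "b \<noteq> 0" "ext_less G (v0 b) (v0 a)" "closed_ball G v0 (v0 a) c \<in> A" for a b c
    using A that fin[OF that(1)] valuation_in_ext_carrier[OF v0, of a] unfolding approx_type_def by metis
  have oc: "closed_ball G v0 (v0 a) c \<in> A" if "v0 a = Fin \<gamma>" "open_ball G v0 \<gamma> c \<in> A" for a c \<gamma>
    using A that fin'[OF that(1)] unfolding approx_type_def by metis
  have chain: "points B \<subseteq> points B' \<or> points B' \<subseteq> points B" if "B \<in> A" "B' \<in> A" for B B'
    using A that unfolding approx_type_def by blast
  show ?thesis
  proof
    fix a c d :: 'k assume a: "a \<noteq> 0"
    show "closed_ball G v0 (v0 a) d \<in> A" if "closed_ball G v0 (v0 a) c \<in> A" "d \<in> cdisc a c"
      using that cdisc_center[OF that(2)] by (simp add: cb)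
    show "\<exists>\<gamma>. v0 a = Fin \<gamma> \<and> open_ball G v0 \<gamma> d \<in> A"
      if "\<exists>\<gamma>. v0 a = Fin \<gamma> \<and> open_ball G v0 \<gamma> c \<in> A" "d \<in> odisc a c"
      using that odisc_center[OF that(2)] by (auto simp: ob)
  next
    fix a b c :: 'k assume a: "a \<noteq> 0"
    show "closed_ball G v0 (v0 b) c \<in> A" if "closed_ball G v0 (v0 a) c \<in> A" "r (j a) (j b)"
      using leq[OF that(2)] down[OF nz[OF a that(2)]] that by auto
    show "\<exists>\<gamma>. v0 b = Fin \<gamma> \<and> open_ball G v0 \<gamma> c \<in> A" if "closed_ball G v0 (v0 a) c \<in> A" "lt (j a) (j b)"
      using down[OF nz[OF a lt_imp_le[OF that(2)]] less[OF that(2)] that(1)] by blast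
    show "\<exists>\<gamma>. v0 b = Fin \<gamma> \<and> open_ball G v0 \<gamma> c \<in> A"
      if "\<exists>\<gamma>. v0 a = Fin \<gamma> \<and> open_ball G v0 \<gamma> c \<in> A" "r (j a) (j b)"
      using leq[OF that(2)] down[OF nz[OF a that(2)], of a c] oc[of a] that by auto
  next
    fix a c assume "a \<noteq> 0" "\<exists>\<gamma>. v0 a = Fin \<gamma> \<and> open_ball G v0 \<gamma> c \<in> A"
    then show "closed_ball G v0 (v0 a) c \<in> A" using oc by blast
  next
    let ?I = "{cdisc a c | a c. a \<noteq> 0 \<and> closed_ball G v0 (v0 a) c \<in> A} \<union>
      {odisc a c | a c. a \<noteq> 0 \<and> (\<exists>\<gamma>. v0 a = Fin \<gamma> \<and> open_ball G v0 \<gamma> c \<in> A)}"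
    have pts: "\<exists>b\<in>A. points b = B" if B: "B \<in> ?I" for B
    proof -
      consider a c where "B = cdisc a c" "closed_ball G v0 (v0 a) c \<in> A"
        | a c \<gamma> where "B = odisc a c" "v0 a = Fin \<gamma>" "open_ball G v0 \<gamma> c \<in> A"
        using B by blast
      then show ?thesis
      proof cases
        case 1
        then show ?thesis using cb[of a c] by (intro bexI[of _ "closed_ball G v0 (v0 a) c"]) simp_all
      next
        case 2
        then show ?thesis using ob[OF 2(2), of c] by (intro bexI[of _ "open_ball G v0 \<gamma> c"]) simp_all
      qed
    qed
    fix B B' assume "B \<in> ?I" "B' \<in> ?I"
    then obtain b b' where "b \<in> A" "b' \<in> A" "points b = B" "points b' = B'" using pts by meson
    then show "B \<subseteq> B' \<or> B' \<subseteq> B" using chain by blast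
  qed
qed

end

theorem theorem1p3:
  fixes G :: "'g ogroup" and v0 :: "'k::field \<Rightarrow> 'g ext" and e :: "'k poly fract \<Rightarrow> 'u"
  assumes "valuation G v0"
    and "(\<forall>p :: 'k poly. 0 < Polynomial.degree p \<longrightarrow> (\<exists>z. poly p z = 0)) \<or>
         dense_in_alg_closure TYPE('w) G v0"
    and "inj e"
  shows "appr const_fract G var_fract respects
           (extension_equiv const_fract G v0 :: ('g, 'u, 'k poly fract) extension rel) \<and>
         bij_betw (\<lambda>C. the_elem (appr const_fract G var_fract ` C))
           (extension_classes const_fract G v0 :: ('g, 'u, 'k poly fract) extension set set)
           {A. approx_type G v0 A \<and> \<not> trivial_type G A}"
proof -
  note v0 = assms(1)
  obtain r where r: "dense_valued r (to_ac :: 'k \<Rightarrow> _)" "\<And>a b. r (to_ac a) (to_ac b) \<longleftrightarrow> val_le G v0 a b"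
    using dense_valued_closure[OF assms(1,2)] by blast
  let ?ap = "appr const_fract G var_fract :: ('g, 'u, 'k poly fract) extension \<Rightarrow> _"
  let ?E = "extensions const_fract G v0 :: ('g, 'u, 'k poly fract) extension set"
  let ?eq = "extension_equiv const_fract G v0 :: ('g, 'u, 'k poly fract) extension rel"
  interpret dense_valued r "to_ac :: 'k \<Rightarrow> _" by (rule r(1))
  have respects: "?ap E = ?ap E'" if EE: "(E, E') \<in> ?eq" for E E'
  proof -
    obtain H \<iota> v H' \<iota>' v' where eq: "E = (H, \<iota>, v)" "E' = (H', \<iota>', v')" by (cases E; cases E')
    have E: "(H, \<iota>, v) \<in> ?E" "(H', \<iota>', v') \<in> ?E" "equivalent_over G (H, \<iota>, v) (H', \<iota>', v')"
      using EE unfolding eq extension_equiv_def by blast+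
    have "val_le H v = val_le H' v'" using equivalent_imp_val_le[OF E(1,3)] .
    then show ?thesis unfolding eq
      by (intro type_eqI[OF v0] appr_subset_balls[OF v0] E)
        (simp_all only: closed_ball_in_appr[OF v0 E(1)] closed_ball_in_appr[OF v0 E(2)]
          open_ball_in_appr[OF v0 E(1)] open_ball_in_appr[OF v0 E(2)])
  qed
  have inj: "(E, E') \<in> ?eq" if E: "E \<in> ?E" "E' \<in> ?E" and ap: "?ap E = ?ap E'" for E E'
  proof -
    obtain H \<iota> v H' \<iota>' v' where eq: "E = (H, \<iota>, v)" "E' = (H', \<iota>', v')" by (cases E; cases E')
    note E = E[unfolded eq] and ap = ap[unfolded eq]
    note V = extension_val_le(1)[OF v0 E(1)] and V' = extension_val_le(1)[OF v0 E(2)]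
    define le1 where "le1 f g \<longleftrightarrow> val_le H v (to_fract f) (to_fract g)" for f g
    define le2 where "le2 f g \<longleftrightarrow> val_le H' v' (to_fract f) (to_fract g)" for f g
    have "valuative le1" unfolding le1_def by (rule valuative.pullback[OF V]) auto
    moreover have "valuative le2" unfolding le2_def by (rule valuative.pullback[OF V']) auto
    moreover have c1: "le1 [:a:] [:b:] \<longleftrightarrow> r (to_ac a) (to_ac b)" for a b
      using extension_val_le(2)[OF v0 E(1), of a b] r(2) by (simp add: le1_def const_fract_def)
    moreover have c2: "le2 [:a:] [:b:] \<longleftrightarrow> r (to_ac a) (to_ac b)" for a b
      using extension_val_le(2)[OF v0 E(2), of a b] r(2) by (simp add: le2_def const_fract_def)
    moreover have "le1 [:- c, 1:] [:a:] \<longleftrightarrow> le2 [:- c, 1:] [:a:]" for a c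
      using closed_ball_in_appr[OF v0 E(1), of a c] closed_ball_in_appr[OF v0 E(2), of a c] ap
      by (simp add: le1_def le2_def flip: var_minus_const const_fract_def)
    moreover have "le1 [:a:] [:- c, 1:] \<longleftrightarrow> le2 [:a:] [:- c, 1:]" for a c
    proof (cases "a = 0")
      case True
      then show ?thesis
        using valuative.zero_le[OF \<open>valuative le1\<close>] valuative.zero_le[OF \<open>valuative le2\<close>] by simp
    next
      case False
      then obtain \<gamma> where "v0 a = Fin \<gamma>" using valuation_finite(1)[OF v0] by blast
      then show ?thesis
        using open_ball_in_appr[OF v0 E(1), of a \<gamma> c] open_ball_in_appr[OF v0 E(2), of a \<gamma> c] ap
        by (simp add: le1_def le2_def flip: var_minus_const const_fract_def)
    qed
    ultimately have "extension_pair r to_ac le1 le2"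
      by (intro extension_pair.intro extension_pair_axioms.intro poly_valuative.intro r(1)) auto
    then have le: "le1 f g \<longleftrightarrow> le2 f g" for f g by (rule extension_pair.relations_eq)
    have "val_le H v f g \<longleftrightarrow> val_le H' v' f g" for f g
      by (rule valuative_fract_eqI[OF V V']) (use le in \<open>simp add: le1_def le2_def\<close>)
    then have "val_le H v = val_le H' v'" by (simp add: fun_eq_iff)
    then show ?thesis
      using val_le_imp_equivalent[OF v0 E] E unfolding eq extension_equiv_def by simp
  qed
  have surj: "\<exists>E\<in>?E. ?ap E = A" if A: "approx_type G v0 A" "\<not> trivial_type G A" for A
  proof -
    interpret nest r to_ac "\<lambda>a c. closed_ball G v0 (v0 a) c \<in> A"
      "\<lambda>a c. \<exists>\<gamma>. v0 a = Fin \<gamma> \<and> open_ball G v0 \<gamma> c \<in> A"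
      using nest_approx_type[OF v0 r A(1)] .
    obtain R where "realizes R" using ex_realizes by blast
    then have R: "valuative R" "\<And>a b. R [:a:] [:b:] \<longleftrightarrow> val_le G v0 a b"
      "\<And>a c. a \<noteq> 0 \<Longrightarrow> R [:- c, 1:] [:a:] \<longleftrightarrow> closed_ball G v0 (v0 a) c \<in> A"
      "\<And>a c. a \<noteq> 0 \<Longrightarrow> \<not> R [:a:] [:- c, 1:] \<longleftrightarrow> (\<exists>\<gamma>. v0 a = Fin \<gamma> \<and> open_ball G v0 \<gamma> c \<in> A)"
      using r(2) unfolding realizes_def by blast+
    have const: "fract_le R (const_fract a) (const_fract b) \<longleftrightarrow> val_le G v0 a b" for a b
      by (simp add: const_fract_def fract_le_to_fract[OF R(1)] R(2))
    obtain H and \<iota> :: "'g \<Rightarrow> 'u" and v where E: "(H, \<iota>, v) \<in> extensions const_fract G v0" "val_le H v = fract_le R"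
      by (rule valuative_extension[OF v0 valuative.valuative_fract[OF R(1)]
            const_fract_hom(1,2) const assms(3)])
    have tf: "val_le H v (to_fract f) (to_fract g) \<longleftrightarrow> R f g" for f g
      by (simp add: E(2) fract_le_to_fract[OF R(1)])
    have "?ap (H, \<iota>, v) = A"
    proof (rule type_eqI[OF v0 appr_subset_balls[OF v0 E(1)]])
      show "A \<subseteq> balls G v0" using A(1) by (simp add: approx_type_def)
      show "closed_ball G v0 (v0 a) c \<in> ?ap (H, \<iota>, v) \<longleftrightarrow> closed_ball G v0 (v0 a) c \<in> A" for a c
      proof (cases "a = 0")
        case True
        then have "v0 a = Infty" using v0 by (simp add: valuation_def)
        moreover have "closed_ball G v0 Infty c \<notin> B" if "\<not> trivial_type G B" for B :: "('k, 'g) ball set"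
          using that by (auto simp: trivial_type_def supp_def ext_carrier_def closed_ball_def)
        ultimately show ?thesis using A(2) not_trivial_appr[OF v0 E(1)] by metis
      next
        case False
        then show ?thesis
          using closed_ball_in_appr[OF v0 E(1), of a c] R(3)[OF False, of c] tf[of "[:- c, 1:]" "[:a:]"]
          by (simp flip: var_minus_const const_fract_def)
      qed
      show "open_ball G v0 \<gamma> c \<in> ?ap (H, \<iota>, v) \<longleftrightarrow> open_ball G v0 \<gamma> c \<in> A" if a: "v0 a = Fin \<gamma>" for a \<gamma> c
      proof -
        have "a \<noteq> 0" using a valuation_finite(3)[OF v0, of a] by auto
        then show ?thesis
          using open_ball_in_appr[OF v0 E(1) a, of c] R(4)[of a c] tf[of "[:a:]" "[:- c, 1:]"] a
          by (simp flip: var_minus_const const_fract_def)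
      qed
    qed
    then show ?thesis using E(1) by blast
  qed
  have equiv: "equiv ?E ?eq" by (rule equiv_extension_equiv)
  have elem: "the_elem (?ap ` (?eq `` {E})) = ?ap E" if E: "E \<in> ?E" for E
  proof -
    have "?ap E' = ?ap E" if "E' \<in> ?eq `` {E}" for E'
      using respects[of E E'] that by simp
    then have "?ap ` (?eq `` {E}) = {?ap E}"
      using equiv_class_self[OF equiv E] by blast
    then show ?thesis by simp
  qed
  have "bij_betw (\<lambda>C. the_elem (?ap ` C)) (?E // ?eq) {A. approx_type G v0 A \<and> \<not> trivial_type G A}"
    unfolding bij_betw_def
  proof
    show "inj_on (\<lambda>C. the_elem (?ap ` C)) (?E // ?eq)"
    proof (rule inj_onI)
      fix C C' assume "C \<in> ?E // ?eq" "C' \<in> ?E // ?eq" and eq: "the_elem (?ap ` C) = the_elem (?ap ` C')"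
      then obtain E E' where E: "E \<in> ?E" "C = ?eq `` {E}" "E' \<in> ?E" "C' = ?eq `` {E'}"
        by (meson quotientE)
      then have "?ap E = ?ap E'" using eq elem by simp
      then show "C = C'" using inj E equiv_class_eq[OF equiv] by simp
    qed
    show "(\<lambda>C. the_elem (?ap ` C)) ` (?E // ?eq) = {A. approx_type G v0 A \<and> \<not> trivial_type G A}"
    proof (intro equalityI subsetI)
      fix A assume "A \<in> (\<lambda>C. the_elem (?ap ` C)) ` (?E // ?eq)"
      then obtain E where E: "E \<in> ?E" "A = ?ap E" using elem by (auto elim!: quotientE)
      obtain H \<iota> v where eq: "E = (H, \<iota>, v)" by (cases E)
      show "A \<in> {A. approx_type G v0 A \<and> \<not> trivial_type G A}"
        using approx_type_appr[OF v0] not_trivial_appr[OF v0] E unfolding eq by blast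
    next
      fix A assume "A \<in> {A. approx_type G v0 A \<and> \<not> trivial_type G A}"
      then obtain E where E: "E \<in> ?E" "?ap E = A" using surj by blast
      then have "A = the_elem (?ap ` (?eq `` {E}))" using elem by simp
      then show "A \<in> (\<lambda>C. the_elem (?ap ` C)) ` (?E // ?eq)" using quotientI[OF E(1)] by blast
    qed
  qed
  then show ?thesis using congruentI[OF respects] by (simp add: extension_classes_def)
qed

end
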